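(* Let $G$ be a bridgeless cubic graph with an even number of edges and let $k\ge1$. Then every graph $S_k(G)$ obtained by the construction below is a $4k$-edge-connected $4k$-graph that does not contain $4k-2$ pairwise disjoint perfect matchings.
   Context: Graphs may have parallel edges but no loops. An $r$-graph is an $r$-regular graph $H$ with $|\partial_H(S)|\ge r$ for every $S\subseteq V(H)$ of odd size, where $\partial_H(S)$ is the set of edges with exactly one end in $S$. Petersen graph $P$: vertices $v_1,\dots,v_5,u_1,\dots,u_5$, with 5-cycles $v_1v_2v_3v_4v_5$ and $u_1u_3u_5u_2u_4$ and edges $u_iv_i$. $M_0=\{u_iv_i\}_{i=1}^5$; for $i\in\{1,\dots,5\}$, $M_i$ is the unique perfect matching of $P$ other than $M_0$ containing $u_iv_i$. $P_k$ is obtained from $P$ by adding $k$ parallel copies of each edge of $M_0$ and $k-1$ parallel copies of each edge of $M_1$, $M_3$, $M_4$. $Q_k$ is obtained from two copies $P_k^1,P_k^2$ of $P_k$ by deleting all edges between $u_1^i$ and $v_1^i$ ($i=1,2$) and identifying $u_1^1$ with $u_1^2$. $T_k$ is the graph on three vertices $x_1,x_2,x_3$ with $k$ parallel edges between each pair. $S_k(G)$: replace each vertex $v$ of $G$ by a copy $T_k^v$ of $T_k$ and each edge $e$ of $G$ by a copy $Q_k^e$ of $Q_k$, with $v_1^1$ of $Q_k^e$ assigned to one end of $e$ and $v_1^2$ to the other. For each vertex $v$ with incident edges $e_1,e_2,e_3$, the vertex of $Q_k^{e_j}$ assigned to $v$ is joined by $k$ parallel edges to each of two vertices of $T_k^v$,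 the three pairs used for $e_1,e_2,e_3$ being the three distinct pairs $\{x_1,x_2\},\{x_2,x_3\},\{x_3,x_1\}$.
   Formalization: The graph G is additionally assumed to be connected (and non-empty); for disconnected G, such as two disjoint copies of K4, the graph S_k(G) is disconnected and the claim of 4k-edge-connectivity fails. *)

theory Defs
  imports Main
begin

text \<open>Finite loopless graphs with parallel edges: edges have names of their own, and
  each edge has a two-element set of ends.\<close>

record ('v, 'e) mgraph =
  verts :: "'v set"
  edges :: "'e set"
  ends :: "'e \<Rightarrow> 'v set"

definition graph :: "('v, 'e) mgraph \<Rightarrow> bool" where
  "graph G \<longleftrightarrow> finite (verts G) \<and> finite (edges G) \<and>
     (\<forall>e\<in>edges G. ends G e \<subseteq> verts G \<and> card (ends G e) = 2)"

definition incident :: "('v, 'e) mgraph \<Rightarrow> 'v \<Rightarrow> 'e set" where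
  "incident G v = {e \<in> edges G. v \<in> ends G e}"

definition regular :: "nat \<Rightarrow> ('v, 'e) mgraph \<Rightarrow> bool" where
  "regular r G \<longleftrightarrow> (\<forall>v\<in>verts G. card (incident G v) = r)"

definition boundary :: "('v, 'e) mgraph \<Rightarrow> 'v set \<Rightarrow> 'e set" where
  "boundary G S = {e \<in> edges G. card (ends G e \<inter> S) = 1}"

definition r_graph :: "nat \<Rightarrow> ('v, 'e) mgraph \<Rightarrow> bool" where
  "r_graph r G \<longleftrightarrow> graph G \<and> regular r G \<and>
     (\<forall>S \<subseteq> verts G. odd (card S) \<longrightarrow> r \<le> card (boundary G S))"

definition adjacency :: "('v, 'e) mgraph \<Rightarrow> ('v \<times> 'v) set" where
  "adjacency G = {(x, y). \<exists>e\<in>edges G. ends G e = {x, y}}"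

definition connected :: "('v, 'e) mgraph \<Rightarrow> bool" where
  "connected G \<longleftrightarrow> verts G \<noteq> {} \<and>
     (\<forall>x\<in>verts G. \<forall>y\<in>verts G. (x, y) \<in> (adjacency G)\<^sup>*)"

definition delete_edges :: "('v, 'e) mgraph \<Rightarrow> 'e set \<Rightarrow> ('v, 'e) mgraph" where
  "delete_edges G F = G\<lparr>edges := edges G - F\<rparr>"

definition bridge :: "('v, 'e) mgraph \<Rightarrow> 'e \<Rightarrow> bool" where
  "bridge G e \<longleftrightarrow> e \<in> edges G \<and>
     (\<exists>x y. ends G e = {x, y} \<and> (x, y) \<notin> (adjacency (delete_edges G {e}))\<^sup>*)"

definition bridgeless :: "('v, 'e) mgraph \<Rightarrow> bool" where
  "bridgeless G \<longleftrightarrow> (\<forall>e. \<not> bridge G e)"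

definition edge_connected :: "nat \<Rightarrow> ('v, 'e) mgraph \<Rightarrow> bool" where
  "edge_connected k G \<longleftrightarrow> 1 < card (verts G) \<and>
     (\<forall>F \<subseteq> edges G. card F < k \<longrightarrow> connected (delete_edges G F))"

definition perfect_matching :: "('v, 'e) mgraph \<Rightarrow> 'e set \<Rightarrow> bool" where
  "perfect_matching G M \<longleftrightarrow> M \<subseteq> edges G \<and> (\<forall>v\<in>verts G. \<exists>!e. e \<in> M \<and> v \<in> ends G e)"

definition has_disjoint_perfect_matchings :: "nat \<Rightarrow> ('v, 'e) mgraph \<Rightarrow> bool" where
  "has_disjoint_perfect_matchings n G \<longleftrightarrow>
     (\<exists>\<M>. finite \<M> \<and> card \<M> = n \<and> (\<forall>M\<in>\<M>. perfect_matching G M) \<and> pairwise disjnt \<M>)"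

text \<open>\<open>(e, 0)\<close> is the original edge \<open>e\<close>; \<open>(e, 1), \<dots>, (e, a e)\<close> are its added parallel copies.\<close>

definition add_parallel :: "('e \<Rightarrow> nat) \<Rightarrow> ('v, 'e) mgraph \<Rightarrow> ('v, 'e \<times> nat) mgraph" where
  "add_parallel a G =
     \<lparr>verts = verts G, edges = (SIGMA e:edges G. {0..a e}), ends = (\<lambda>(e, j). ends G e)\<rparr>"

datatype pvertex = V nat | U nat

definition petersen :: "(pvertex, pvertex set) mgraph" where
  "petersen =
     \<lparr>verts = V ` {1..5} \<union> U ` {1..5},
      edges =
        {{V 1, V 2}, {V 2, V 3}, {V 3, V 4}, {V 4, V 5}, {V 5, V 1}} \<union>
        {{U 1, U 3}, {U 3, U 5}, {U 5, U 2}, {U 2, U 4}, {U 4, U 1}} \<union>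
        (\<lambda>i. {U i, V i}) ` {1..5},
      ends = (\<lambda>e. e)\<rparr>"

definition M0 :: "pvertex set set" where
  "M0 = (\<lambda>i. {U i, V i}) ` {1..5}"

definition PM :: "nat \<Rightarrow> pvertex set set" where
  "PM i = (THE M. perfect_matching petersen M \<and> M \<noteq> M0 \<and> {U i, V i} \<in> M)"

definition P_graph :: "nat \<Rightarrow> (pvertex, pvertex set \<times> nat) mgraph" where
  "P_graph k = add_parallel
     (\<lambda>e. k * of_bool (e \<in> M0) +
          (k - 1) * (of_bool (e \<in> PM 1) + of_bool (e \<in> PM 3) + of_bool (e \<in> PM 4)))
     petersen"

text \<open>\<open>QV i x\<close> is the vertex \<open>x\<close> of the \<open>i\<close>-th copy of \<open>P_graph k\<close> (\<open>i = 1, 2\<close>);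
  \<open>Hub\<close> is the vertex obtained by identifying the two copies of \<open>U 1\<close>.\<close>

datatype qvertex = Hub | QV nat pvertex

definition q_vertex :: "nat \<Rightarrow> pvertex \<Rightarrow> qvertex" where
  "q_vertex i x = (if x = U 1 then Hub else QV i x)"

type_synonym qedge = "nat \<times> (pvertex set \<times> nat)"

definition Q_graph :: "nat \<Rightarrow> (qvertex, qedge) mgraph" where
  "Q_graph k =
     \<lparr>verts = {q_vertex i x | i x. i \<in> {1, 2} \<and> x \<in> verts (P_graph k)},
      edges = {1, 2} \<times> {e \<in> edges (P_graph k). ends (P_graph k) e \<noteq> {U 1, V 1}},
      ends = (\<lambda>(i, e). q_vertex i ` ends (P_graph k) e)\<rparr>"

definition T_pairs :: "nat set set" where
  "T_pairs = {{1, 2}, {2, 3}, {3, 1}}"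

definition T_graph :: "nat \<Rightarrow> (nat, nat set \<times> nat) mgraph" where
  "T_graph k = \<lparr>verts = {1, 2, 3}, edges = T_pairs \<times> {0..<k}, ends = fst\<rparr>"

datatype ('v, 'e) svertex = InT 'v nat | InQ 'e qvertex

text \<open>\<open>Join v e x j\<close> is the \<open>j\<close>-th of the parallel edges that join vertex \<open>x\<close> of the copy of
  \<open>T_graph k\<close> at \<open>v\<close> to the vertex of the copy of \<open>Q_graph k\<close> at \<open>e\<close> assigned to \<open>v\<close>.\<close>

datatype ('v, 'e) sedge = TEdge 'v "nat set \<times> nat" | QEdge 'e qedge | Join 'v 'e nat nat

text \<open>The choices in the construction: \<open>f e\<close> is the end of \<open>e\<close> to which \<open>QV 1 (V 1)\<close> is
  assigned (\<open>QV 2 (V 1)\<close> goes to the other end), and \<open>p v e\<close> is the pair of vertices of the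
  copy of \<open>T_graph k\<close> at \<open>v\<close> that is used for the edge \<open>e\<close> incident with \<open>v\<close>.\<close>

definition S_choice :: "('v, 'e) mgraph \<Rightarrow> ('e \<Rightarrow> 'v) \<Rightarrow> ('v \<Rightarrow> 'e \<Rightarrow> nat set) \<Rightarrow> bool" where
  "S_choice G f p \<longleftrightarrow> (\<forall>e\<in>edges G. f e \<in> ends G e) \<and>
     (\<forall>v\<in>verts G. bij_betw (p v) (incident G v) T_pairs)"

definition assigned :: "('e \<Rightarrow> 'v) \<Rightarrow> 'v \<Rightarrow> 'e \<Rightarrow> qvertex" where
  "assigned f v e = (if v = f e then QV 1 (V 1) else QV 2 (V 1))"

definition S_graph ::
  "nat \<Rightarrow> ('v, 'e) mgraph \<Rightarrow> ('e \<Rightarrow> 'v) \<Rightarrow> ('v \<Rightarrow> 'e \<Rightarrow> nat set)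
    \<Rightarrow> (('v, 'e) svertex, ('v, 'e) sedge) mgraph" where
  "S_graph k G f p =
     \<lparr>verts = {InT v x | v x. v \<in> verts G \<and> x \<in> verts (T_graph k)} \<union>
              {InQ e y | e y. e \<in> edges G \<and> y \<in> verts (Q_graph k)},
      edges = {TEdge v t | v t. v \<in> verts G \<and> t \<in> edges (T_graph k)} \<union>
              {QEdge e q | e q. e \<in> edges G \<and> q \<in> edges (Q_graph k)} \<union>
              {Join v e x j | v e x j.
                 v \<in> verts G \<and> e \<in> incident G v \<and> x \<in> p v e \<and> j < k},
      ends = (\<lambda>d. case d of
                TEdge v t \<Rightarrow> InT v ` ends (T_graph k) t
              | QEdge e q \<Rightarrow> InQ e ` ends (Q_graph k) q
              | Join v e x j \<Rightarrow> {InT v x, InQ e (assigned f v e)})\<rparr>"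

end

theory Submission
  imports Defs
begin

text \<open>Connectivity: in a copy of \<open>P_graph k\<close> without the edges between \<open>U 1\<close> and \<open>V 1\<close>, a cut
  separating these two vertices has at least \<open>2 k\<close> edges and any other nontrivial cut at least
  \<open>4 k\<close>. A cut of the whole graph with fewer than \<open>4 k\<close> edges is therefore a cut of a subdivision
  of \<open>G\<close> in which every edge has weight \<open>2 k\<close>; it crosses at most one edge of that subdivision,
  which contradicts that \<open>G\<close> is connected and bridgeless.

  Matchings: a copy of \<open>Q_graph k\<close> has an odd number of vertices and two contact vertices, so a perfect
  matching leaves it through exactly one of them. If it does not leave through a given one, then it
  induces in that half one of the four perfect matchings of the Petersen graph that avoid
  \<open>{U 1, V 1}\<close>; the multiplicities allow this for at most \<open>2 k - 1\<close> disjoint matchings. Among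
  \<open>4 k - 2\<close> disjoint perfect matchings, exactly \<open>2 k - 1\<close> hence leave through each contact vertex, and
  the triangle at a vertex of \<open>G\<close> is entered \<open>3 (2 k - 1)\<close> times in total. But every matching enters
  a triangle an odd number of times, and \<open>4 k - 2\<close> odd numbers have an even sum.\<close>

section \<open>The Petersen graph and its weights\<close>

text \<open>The matching condition at a vertex of degree three as a propositional formula. Perfect
  matchings of the Petersen graph thereby become the solutions of a Boolean system in fifteen
  unknowns.\<close>

definition one3 :: "bool \<Rightarrow> bool \<Rightarrow> bool \<Rightarrow> bool" where
  "one3 a b c \<longleftrightarrow> (a \<or> b \<or> c) \<and> \<not> (a \<and> b) \<and> \<not> (a \<and> c) \<and> \<not> (b \<and> c)"

lemma interval_1_5: "{1..5} = {1, 2, 3, 4, 5 :: nat}"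
  by auto

lemma verts_petersen:
  "verts petersen = {V 1, V 2, V 3, V 4, V 5, U 1, U 2, U 3, U 4, U 5}"
  by (auto simp: petersen_def interval_1_5 simp del: One_nat_def)

lemma M0_eq: "M0 = {{U 1, V 1}, {U 2, V 2}, {U 3, V 3}, {U 4, V 4}, {U 5, V 5}}"
  by (simp add: M0_def interval_1_5 del: One_nat_def)

lemma edges_petersen:
  "edges petersen =
    {{V 1, V 2}, {V 2, V 3}, {V 3, V 4}, {V 4, V 5}, {V 5, V 1},
     {U 1, U 3}, {U 3, U 5}, {U 5, U 2}, {U 2, U 4}, {U 4, U 1},
     {U 1, V 1}, {U 2, V 2}, {U 3, V 3}, {U 4, V 4}, {U 5, V 5}}"
  by (simp add: petersen_def interval_1_5 Un_insert_left del: One_nat_def) (simp only: insert_commute)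

lemma ends_petersen [simp]: "ends petersen e = e"
  by (simp add: petersen_def)

text \<open>A list makes the incidence sets computable: \<open>set_filter\<close> reduces each of
  them to filtering this list.\<close>

lemma edges_petersen_list:
  "edges petersen = set
    [{V 1, V 2}, {V 2, V 3}, {V 3, V 4}, {V 4, V 5}, {V 5, V 1},
     {U 1, U 3}, {U 3, U 5}, {U 5, U 2}, {U 2, U 4}, {U 4, U 1},
     {U 1, V 1}, {U 2, V 2}, {U 3, V 3}, {U 4, V 4}, {U 5, V 5}]"
  by (simp only: edges_petersen list.set)

lemma incident_petersen:
  "incident petersen (V 1) = {{V 1, V 2}, {V 5, V 1}, {U 1, V 1}}"
  "incident petersen (V 2) = {{V 1, V 2}, {V 2, V 3}, {U 2, V 2}}"
  "incident petersen (V 3) = {{V 2, V 3}, {V 3, V 4}, {U 3, V 3}}"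
  "incident petersen (V 4) = {{V 3, V 4}, {V 4, V 5}, {U 4, V 4}}"
  "incident petersen (V 5) = {{V 4, V 5}, {V 5, V 1}, {U 5, V 5}}"
  "incident petersen (U 1) = {{U 1, U 3}, {U 4, U 1}, {U 1, V 1}}"
  "incident petersen (U 2) = {{U 5, U 2}, {U 2, U 4}, {U 2, V 2}}"
  "incident petersen (U 3) = {{U 1, U 3}, {U 3, U 5}, {U 3, V 3}}"
  "incident petersen (U 4) = {{U 2, U 4}, {U 4, U 1}, {U 4, V 4}}"
  "incident petersen (U 5) = {{U 3, U 5}, {U 5, U 2}, {U 5, V 5}}"
  unfolding incident_def edges_petersen_list set_filter[symmetric] ends_petersen
  by (simp_all del: One_nat_def)

lemma ex1_one3:
  assumes "N \<subseteq> edges petersen" and "incident petersen x = {a, b, c}"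
    and "a \<noteq> b" "a \<noteq> c" "b \<noteq> c"
  shows "(\<exists>!e. e \<in> N \<and> x \<in> e) \<longleftrightarrow> one3 (a \<in> N) (b \<in> N) (c \<in> N)"
proof -
  have "e \<in> N \<and> x \<in> e \<longleftrightarrow> e \<in> N \<and> (e = a \<or> e = b \<or> e = c)" for e
    using assms(1,2) by (auto simp: incident_def)
  then show ?thesis using assms(3-) unfolding one3_def
    by (cases "a \<in> N"; cases "b \<in> N"; cases "c \<in> N") auto
qed

lemma ex1_petersen:
  assumes "N \<subseteq> edges petersen"
  shows
    "(\<exists>!e. e \<in> N \<and> V 1 \<in> e) \<longleftrightarrow> one3 ({V 1, V 2} \<in> N) ({V 5, V 1} \<in> N) ({U 1, V 1} \<in> N)"
    "(\<exists>!e. e \<in> N \<and> V 2 \<in> e) \<longleftrightarrow> one3 ({V 1, V 2} \<in> N) ({V 2, V 3} \<in> N) ({U 2, V 2} \<in> N)"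
    "(\<exists>!e. e \<in> N \<and> V 3 \<in> e) \<longleftrightarrow> one3 ({V 2, V 3} \<in> N) ({V 3, V 4} \<in> N) ({U 3, V 3} \<in> N)"
    "(\<exists>!e. e \<in> N \<and> V 4 \<in> e) \<longleftrightarrow> one3 ({V 3, V 4} \<in> N) ({V 4, V 5} \<in> N) ({U 4, V 4} \<in> N)"
    "(\<exists>!e. e \<in> N \<and> V 5 \<in> e) \<longleftrightarrow> one3 ({V 4, V 5} \<in> N) ({V 5, V 1} \<in> N) ({U 5, V 5} \<in> N)"
    "(\<exists>!e. e \<in> N \<and> U 1 \<in> e) \<longleftrightarrow> one3 ({U 1, U 3} \<in> N) ({U 4, U 1} \<in> N) ({U 1, V 1} \<in> N)"
    "(\<exists>!e. e \<in> N \<and> U 2 \<in> e) \<longleftrightarrow> one3 ({U 5, U 2} \<in> N) ({U 2, U 4} \<in> N) ({U 2, V 2} \<in> N)"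
    "(\<exists>!e. e \<in> N \<and> U 3 \<in> e) \<longleftrightarrow> one3 ({U 1, U 3} \<in> N) ({U 3, U 5} \<in> N) ({U 3, V 3} \<in> N)"
    "(\<exists>!e. e \<in> N \<and> U 4 \<in> e) \<longleftrightarrow> one3 ({U 2, U 4} \<in> N) ({U 4, U 1} \<in> N) ({U 4, V 4} \<in> N)"
    "(\<exists>!e. e \<in> N \<and> U 5 \<in> e) \<longleftrightarrow> one3 ({U 3, U 5} \<in> N) ({U 5, U 2} \<in> N) ({U 5, V 5} \<in> N)"
  by (rule ex1_one3[OF assms incident_petersen(1)] ex1_one3[OF assms incident_petersen(2)]
      ex1_one3[OF assms incident_petersen(3)] ex1_one3[OF assms incident_petersen(4)]
      ex1_one3[OF assms incident_petersen(5)] ex1_one3[OF assms incident_petersen(6)]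
      ex1_one3[OF assms incident_petersen(7)] ex1_one3[OF assms incident_petersen(8)]
      ex1_one3[OF assms incident_petersen(9)] ex1_one3[OF assms incident_petersen(10)];
      simp add: doubleton_eq_iff)+

lemma perfect_matching_petersen_iff:
  "perfect_matching petersen N \<longleftrightarrow> N \<subseteq> edges petersen \<and>
    one3 ({V 1, V 2} \<in> N) ({V 5, V 1} \<in> N) ({U 1, V 1} \<in> N) \<and>
    one3 ({V 1, V 2} \<in> N) ({V 2, V 3} \<in> N) ({U 2, V 2} \<in> N) \<and>
    one3 ({V 2, V 3} \<in> N) ({V 3, V 4} \<in> N) ({U 3, V 3} \<in> N) \<and>
    one3 ({V 3, V 4} \<in> N) ({V 4, V 5} \<in> N) ({U 4, V 4} \<in> N) \<and>
    one3 ({V 4, V 5} \<in> N) ({V 5, V 1} \<in> N) ({U 5, V 5} \<in> N) \<and>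
    one3 ({U 1, U 3} \<in> N) ({U 4, U 1} \<in> N) ({U 1, V 1} \<in> N) \<and>
    one3 ({U 5, U 2} \<in> N) ({U 2, U 4} \<in> N) ({U 2, V 2} \<in> N) \<and>
    one3 ({U 1, U 3} \<in> N) ({U 3, U 5} \<in> N) ({U 3, V 3} \<in> N) \<and>
    one3 ({U 2, U 4} \<in> N) ({U 4, U 1} \<in> N) ({U 4, V 4} \<in> N) \<and>
    one3 ({U 3, U 5} \<in> N) ({U 5, U 2} \<in> N) ({U 5, V 5} \<in> N)"
proof (cases "N \<subseteq> edges petersen")
  case True
  then show ?thesis
    by (simp only: perfect_matching_def verts_petersen ends_petersen ball_simps
        ex1_petersen[OF True] simp_thms)
qed (simp add: perfect_matching_def)

text \<open>The letters \<open>a\<close>, \<open>b\<close>, \<open>s\<close> stand for outer edges,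
  inner edges and spokes. The conditions are those of a matching without the spoke at index 1 that
  covers every vertex except possibly \<open>V 1\<close> and \<open>U 1\<close>. As the number of
  covered vertices is even, both or neither of these are covered. If both are, the matching is one
  of \<open>PM 2\<close>, ..., \<open>PM 5\<close>, told apart by its edges at \<open>V 1\<close>
  and \<open>U 1\<close>; \<open>{V 3, V 4}\<close> lies in \<open>PM 2\<close> and
  \<open>PM 5\<close>, and \<open>{U 5, U 2}\<close> in \<open>PM 3\<close> and
  \<open>PM 4\<close>.\<close>

lemma near_matching:
  assumes "one3 a12 a23 s2" "one3 a23 a34 s3" "one3 a34 a45 s4" "one3 a45 a51 s5"
    "one3 b52 b24 s2" "one3 b13 b35 s3" "one3 b24 b41 s4" "one3 b35 b52 s5"
    "\<not> (a12 \<and> a51)" "\<not> (b13 \<and> b41)"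
  shows "a12 \<or> a51 \<longleftrightarrow> b13 \<or> b41"
    "a12 \<or> a51 \<Longrightarrow> if a12 = b13 then a34 else b52"
  using assms unfolding one3_def by smt+

text \<open>The letters are as in \<open>near_matching\<close>. The spokes used leave an even number
  of vertices on the outer 5-cycle, so their number is odd. Three spokes would leave two indices
  adjacent in both 5-cycles, but no pair of indices is; hence one spoke is used, and each of the two
  remaining paths on four vertices has a unique perfect matching.\<close>

lemma petersen_matching:
  assumes "one3 a12 a51 s1" "one3 a12 a23 s2" "one3 a23 a34 s3" "one3 a34 a45 s4" "one3 a45 a51 s5"
    "one3 b13 b41 s1" "one3 b52 b24 s2" "one3 b13 b35 s3" "one3 b24 b41 s4" "one3 b35 b52 s5"
    "\<not> (s1 \<and> s2 \<and> s3 \<and> s4 \<and> s5)"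
  shows "s1 \<Longrightarrow> a23 \<and> a45 \<and> b35 \<and> b24"
    "s3 \<Longrightarrow> a12 \<and> a45 \<and> b52 \<and> b41"
    "s4 \<Longrightarrow> a23 \<and> a51 \<and> b13 \<and> b52"
  using assms unfolding one3_def by smt+


section \<open>The matchings \<open>PM 1\<close>, \<open>PM 3\<close>, \<open>PM 4\<close> and the
  edge multiplicities\<close>

lemma perfect_matching_subset_eq:
  assumes "graph G" "perfect_matching G A" "perfect_matching G B" "A \<subseteq> B"
  shows "A = B"
proof
  show "B \<subseteq> A"
  proof
    fix e assume e: "e \<in> B"
    then have "e \<in> edges G" using assms(3) by (auto simp: perfect_matching_def)
    then have "ends G e \<subseteq> verts G" "card (ends G e) = 2" using assms(1) by (auto simp: graph_def)
    then obtain v where v: "v \<in> ends G e" "v \<in> verts G" by (auto simp: card_2_iff)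
    then obtain e' where "e' \<in> A" "v \<in> ends G e'" using assms(2) by (auto simp: perfect_matching_def)
    moreover from this have "e' = e" using assms(3,4) v e unfolding perfect_matching_def by blast
    ultimately show "e \<in> A" by simp
  qed
qed fact

lemma graph_petersen: "graph petersen"
  by (auto simp: graph_def edges_petersen verts_petersen)

lemma perfect_matching_M0: "perfect_matching petersen M0"
  unfolding perfect_matching_petersen_iff edges_petersen M0_eq one3_def
  by (simp add: doubleton_eq_iff)

text \<open>Inclusion between perfect matchings is equality. Hence \<open>THE\<close> is resolved by
  the single inclusion \<open>A \<subseteq> M\<close>, and \<open>M \<noteq> M0\<close> becomes
  \<open>\<not> M0 \<subseteq> M\<close>, which is the last premise of
  \<open>petersen_matching\<close>.\<close>

lemma PM_eqI:
  assumes "perfect_matching petersen A" "{U i, V i} \<in> A" "\<not> M0 \<subseteq> A"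
    and "\<And>M. perfect_matching petersen M \<Longrightarrow> \<not> M0 \<subseteq> M \<Longrightarrow> {U i, V i} \<in> M \<Longrightarrow> A \<subseteq> M"
  shows "PM i = A"
  unfolding PM_def
proof (rule the_equality)
  fix M assume M: "perfect_matching petersen M \<and> M \<noteq> M0 \<and> {U i, V i} \<in> M"
  then have "\<not> M0 \<subseteq> M"
    using perfect_matching_subset_eq[OF graph_petersen perfect_matching_M0] by blast
  with M assms(4) have "A \<subseteq> M" by blast
  with M assms(1) show "M = A"
    using perfect_matching_subset_eq[OF graph_petersen] by blast
qed (use assms in auto)

lemma PM_1: "PM 1 = {{U 1, V 1}, {V 2, V 3}, {V 4, V 5}, {U 3, U 5}, {U 2, U 4}}"
proof (rule PM_eqI)
  fix M assume M: "perfect_matching petersen M" "\<not> M0 \<subseteq> M" "{U 1, V 1} \<in> M"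
  show "{{U 1, V 1}, {V 2, V 3}, {V 4, V 5}, {U 3, U 5}, {U 2, U 4}} \<subseteq> M"
    using petersen_matching(1)[of "{V 1, V 2} \<in> M" "{V 5, V 1} \<in> M" "{U 1, V 1} \<in> M"
      "{V 2, V 3} \<in> M" "{U 2, V 2} \<in> M" "{V 3, V 4} \<in> M" "{U 3, V 3} \<in> M"
      "{V 4, V 5} \<in> M" "{U 4, V 4} \<in> M" "{U 5, V 5} \<in> M" "{U 1, U 3} \<in> M" "{U 4, U 1} \<in> M"
      "{U 5, U 2} \<in> M" "{U 2, U 4} \<in> M" "{U 3, U 5} \<in> M"] M
    unfolding perfect_matching_petersen_iff M0_eq by blast
qed (simp_all add: perfect_matching_petersen_iff M0_eq edges_petersen one3_def doubleton_eq_iff)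

lemma PM_3: "PM 3 = {{U 3, V 3}, {V 1, V 2}, {V 4, V 5}, {U 5, U 2}, {U 4, U 1}}"
proof (rule PM_eqI)
  fix M assume M: "perfect_matching petersen M" "\<not> M0 \<subseteq> M" "{U 3, V 3} \<in> M"
  show "{{U 3, V 3}, {V 1, V 2}, {V 4, V 5}, {U 5, U 2}, {U 4, U 1}} \<subseteq> M"
    using petersen_matching(2)[of "{V 1, V 2} \<in> M" "{V 5, V 1} \<in> M" "{U 1, V 1} \<in> M"
      "{V 2, V 3} \<in> M" "{U 2, V 2} \<in> M" "{V 3, V 4} \<in> M" "{U 3, V 3} \<in> M"
      "{V 4, V 5} \<in> M" "{U 4, V 4} \<in> M" "{U 5, V 5} \<in> M" "{U 1, U 3} \<in> M" "{U 4, U 1} \<in> M"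
      "{U 5, U 2} \<in> M" "{U 2, U 4} \<in> M" "{U 3, U 5} \<in> M"] M
    unfolding perfect_matching_petersen_iff M0_eq by blast
qed (simp_all add: perfect_matching_petersen_iff M0_eq edges_petersen one3_def doubleton_eq_iff)

lemma PM_4: "PM 4 = {{U 4, V 4}, {V 2, V 3}, {V 5, V 1}, {U 1, U 3}, {U 5, U 2}}"
proof (rule PM_eqI)
  fix M assume M: "perfect_matching petersen M" "\<not> M0 \<subseteq> M" "{U 4, V 4} \<in> M"
  show "{{U 4, V 4}, {V 2, V 3}, {V 5, V 1}, {U 1, U 3}, {U 5, U 2}} \<subseteq> M"
    using petersen_matching(3)[of "{V 1, V 2} \<in> M" "{V 5, V 1} \<in> M" "{U 1, V 1} \<in> M"
      "{V 2, V 3} \<in> M" "{U 2, V 2} \<in> M" "{V 3, V 4} \<in> M" "{U 3, V 3} \<in> M"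
      "{V 4, V 5} \<in> M" "{U 4, V 4} \<in> M" "{U 5, V 5} \<in> M" "{U 1, U 3} \<in> M" "{U 4, U 1} \<in> M"
      "{U 5, U 2} \<in> M" "{U 2, U 4} \<in> M" "{U 3, U 5} \<in> M"] M
    unfolding perfect_matching_petersen_iff M0_eq by blast
qed (simp_all add: perfect_matching_petersen_iff M0_eq edges_petersen one3_def doubleton_eq_iff)

text \<open>The number of parallel edges of \<open>P_graph k\<close> over \<open>e\<close>;
  \<open>Suc\<close> counts the original edge besides its added copies.\<close>

definition mult :: "nat \<Rightarrow> pvertex set \<Rightarrow> nat" where
  "mult k e = Suc (k * of_bool (e \<in> M0) +
    (k - 1) * (of_bool (e \<in> PM 1) + of_bool (e \<in> PM 3) + of_bool (e \<in> PM 4)))"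

text \<open>The edge \<open>{V 3, V 4}\<close> lies in none of the four matchings and stays simple;
  this is what later pushes a bound \<open>2 * k\<close> down to \<open>2 * k - 1\<close>.\<close>

lemma mult_simps:
  assumes "k \<ge> 1"
  shows "mult k {V 1, V 2} = k" "mult k {V 2, V 3} = 2 * k - 1" "mult k {V 3, V 4} = 1"
    "mult k {V 4, V 5} = 2 * k - 1" "mult k {V 5, V 1} = k"
    "mult k {U 1, U 3} = k" "mult k {U 3, U 5} = k" "mult k {U 5, U 2} = 2 * k - 1"
    "mult k {U 2, U 4} = k" "mult k {U 4, U 1} = k"
    "mult k {U 2, V 2} = k + 1" "mult k {U 3, V 3} = 2 * k" "mult k {U 4, V 4} = 2 * k"
    "mult k {U 5, V 5} = k + 1"
  unfolding mult_def M0_eq PM_1 PM_3 PM_4 using assms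
  by (simp_all add: doubleton_eq_iff)

text \<open>For \<open>k = m + 1\<close>, the multiplicities are \<open>m\<close> times the weights of the first sum plus the weights of
  the second.\<close>

lemma split_weights:
  "\<forall>(v1::bool) v2 v3 v4 v5 u1 u2 u3 u4 u5.
     (let c = (if v1 = u1 then (if v2 = u1 \<and> v3 = u1 \<and> v4 = u1 \<and> v5 = u1 \<and> u2 = u1 \<and> u3 = u1 \<and> u4 = u1 \<and> u5 = u1 then 0 else 4) else 2 :: nat)
   in c \<le> of_bool (v1 \<noteq> v2) + 2 * of_bool (v2 \<noteq> v3) + 2 * of_bool (v4 \<noteq> v5) + of_bool (v5 \<noteq> v1)
   + of_bool (u1 \<noteq> u3) + of_bool (u3 \<noteq> u5) + 2 * of_bool (u5 \<noteq> u2) + of_bool (u2 \<noteq> u4) + of_bool (u4 \<noteq> u1)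
   + of_bool (u2 \<noteq> v2) + 2 * of_bool (u3 \<noteq> v3) + 2 * of_bool (u4 \<noteq> v4) + of_bool (u5 \<noteq> v5) \<and>
   c \<le> of_bool (v1 \<noteq> v2) + of_bool (v2 \<noteq> v3) + of_bool (v3 \<noteq> v4) + of_bool (v4 \<noteq> v5) + of_bool (v5 \<noteq> v1)
   + of_bool (u1 \<noteq> u3) + of_bool (u3 \<noteq> u5) + of_bool (u5 \<noteq> u2) + of_bool (u2 \<noteq> u4) + of_bool (u4 \<noteq> u1)
   + 2 * of_bool (u2 \<noteq> v2) + 2 * of_bool (u3 \<noteq> v3) + 2 * of_bool (u4 \<noteq> v4) + 2 * of_bool (u5 \<noteq> v5))"
  by code_simp

section \<open>Graphs, cuts and matchings\<close>

declare One_nat_def [simp del]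

lemma card_Collect_doubleton:
  assumes "a \<noteq> b"
  shows "card {x \<in> {a, b}. c x} = 1 \<longleftrightarrow> c a \<noteq> c b"
proof -
  have "{x \<in> {a, b}. c x} = (if c a then {a} else {}) \<union> (if c b then {b} else {})"
    by auto
  then have "card {x \<in> {a, b}. c x} = card ((if c a then {a} else {}) \<union> (if c b then {b} else {}))"
    by (rule arg_cong)
  also have "\<dots> = 1 \<longleftrightarrow> c a \<noteq> c b"
    using assms by (cases "c a"; cases "c b") simp_all
  finally show ?thesis .
qed

lemma card_doubleton_Int:
  assumes "a \<noteq> b"
  shows "card ({a, b} \<inter> S) = 1 \<longleftrightarrow> (a \<in> S) \<noteq> (b \<in> S)"
  using card_Collect_doubleton[OF assms, of "\<lambda>x. x \<in> S"] by (simp add: Int_def)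

lemma graph_ends:
  assumes "graph G" "e \<in> edges G"
  obtains a b where "ends G e = {a, b}" "a \<noteq> b" "a \<in> verts G" "b \<in> verts G"
proof -
  have "ends G e \<subseteq> verts G" "card (ends G e) = 2" using assms by (auto simp: graph_def)
  then show thesis using that by (auto simp: card_2_iff)
qed

text \<open>If deleting \<open>F\<close> separates \<open>y\<close> from \<open>x\<close>, then the
  set of vertices still reachable from \<open>x\<close> has its whole boundary inside
  \<open>F\<close>, so this boundary is too small.\<close>

lemma edge_connectedI:
  assumes G: "graph G" and "1 < card (verts G)"
    and cut: "\<And>S. S \<subseteq> verts G \<Longrightarrow> S \<noteq> {} \<Longrightarrow> S \<noteq> verts G \<Longrightarrow> r \<le> card (boundary G S)"
  shows "edge_connected r G"
  unfolding edge_connected_def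
proof (intro conjI allI impI)
  fix F assume F: "F \<subseteq> edges G" "card F < r"
  let ?A = "adjacency (delete_edges G F)"
  have "(x, y) \<in> ?A\<^sup>*" if xy: "x \<in> verts G" "y \<in> verts G" for x y
  proof (rule ccontr)
    assume not_reach: "(x, y) \<notin> ?A\<^sup>*"
    define S where "S = {z \<in> verts G. (x, z) \<in> ?A\<^sup>*}"
    have "boundary G S \<subseteq> F"
    proof (rule subsetI, rule ccontr)
      fix d assume d: "d \<in> boundary G S" "d \<notin> F"
      then have dG: "d \<in> edges G" by (simp add: boundary_def)
      with G obtain a b where ab: "ends G d = {a, b}" "a \<noteq> b" "a \<in> verts G" "b \<in> verts G"
        by (rule graph_ends)
      have "\<exists>e\<in>edges (delete_edges G F). ends (delete_edges G F) e = {a, b}"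
        using ab(1) d(2) dG by (intro bexI[of _ d]) (simp_all add: delete_edges_def)
      then have "(a, b) \<in> ?A" "(b, a) \<in> ?A"
        unfolding adjacency_def by (simp_all add: insert_commute[of b a])
      then have "(x, a) \<in> ?A\<^sup>* \<longleftrightarrow> (x, b) \<in> ?A\<^sup>*"
        by (meson rtrancl.rtrancl_into_rtrancl)
      then have "a \<in> S \<longleftrightarrow> b \<in> S"
        using ab(3,4) by (simp add: S_def)
      moreover have "card ({a, b} \<inter> S) = 1" using d(1) ab(1) by (simp add: boundary_def)
      ultimately show False using card_doubleton_Int[OF ab(2)] by blast
    qed
    moreover have "finite F" using F(1) G unfolding graph_def by (blast intro: finite_subset)
    ultimately have "card (boundary G S) < r" using F(2) card_mono[of F] by (meson le_less_trans)
    moreover have "S \<subseteq> verts G" "x \<in> S" "y \<notin> S" using xy(1) not_reach by (simp_all add: S_def)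
    ultimately show False using cut[of S] xy(2) by (metis empty_iff not_less)
  qed
  moreover have "verts G \<noteq> {}" using assms(2) by (metis card.empty not_less_zero)
  ultimately show "connected (delete_edges G F)"
    by (simp add: connected_def delete_edges_def)
qed fact

lemma handshake:
  assumes "graph G" "regular r G"
  shows "r * card (verts G) = 2 * card (edges G)"
proof -
  have "(\<Sum>v\<in>verts G. card {e \<in> edges G. v \<in> ends G e}) = 2 * card (edges G)"
  proof (rule sum_multicount)
    show "\<forall>e\<in>edges G. card {v \<in> verts G. v \<in> ends G e} = 2"
    proof
      fix e assume "e \<in> edges G"
      then have "{v \<in> verts G. v \<in> ends G e} = ends G e" "card (ends G e) = 2"
        using assms(1) by (auto simp: graph_def)
      then show "card {v \<in> verts G. v \<in> ends G e} = 2" by simp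
    qed
  qed (use assms in \<open>auto simp: graph_def\<close>)
  then show ?thesis using assms(2) by (simp add: regular_def incident_def mult.commute)
qed

text \<open>Turns a degree into the size of a cut, so that one count over a half of
  \<open>Q_graph k\<close> serves both degrees and connectivity.\<close>

lemma boundary_singleton:
  assumes "graph G"
  shows "boundary G {v} = incident G v"
proof -
  have "card (ends G e \<inter> {v}) = 1 \<longleftrightarrow> v \<in> ends G e" for e
    by (cases "v \<in> ends G e") auto
  then show ?thesis by (auto simp: boundary_def incident_def)
qed

lemma perfect_matching_unique:
  assumes "perfect_matching G M" "x \<in> verts G" "d \<in> M" "x \<in> ends G d" "d' \<in> M" "x \<in> ends G d'"
  shows "d = d'"
  using assms unfolding perfect_matching_def by blast

lemma perfect_matching_covers:
  assumes "perfect_matching G M" "x \<in> verts G"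
  obtains d where "d \<in> M" "d \<in> edges G" "x \<in> ends G d"
  using assms unfolding perfect_matching_def by blast

lemma q_vertex_eq_iff: "q_vertex i x = q_vertex i' x' \<longleftrightarrow> x = x' \<and> (x = U 1 \<or> i = i')"
  by (auto simp: q_vertex_def)

lemma q_vertex_simps [simp]:
  "q_vertex i (U 1) = Hub" "q_vertex i (V n) = QV i (V n)"
  by (simp_all add: q_vertex_def)

lemma edges_P_graph: "edges (P_graph k) = (SIGMA d:edges petersen. {..<mult k d})"
  by (auto simp: P_graph_def add_parallel_def mult_def less_Suc_eq_le)

lemma verts_P_graph: "verts (P_graph k) = verts petersen"
  by (simp add: P_graph_def add_parallel_def)

lemma ends_P_graph: "ends (P_graph k) (d, j) = d"
  by (simp add: P_graph_def add_parallel_def)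

section \<open>The construction\<close>

locale S_construction =
  fixes G :: "('v, 'e) mgraph" and k :: nat
    and f :: "'e \<Rightarrow> 'v" and p :: "'v \<Rightarrow> 'e \<Rightarrow> nat set"
  assumes graph_G: "graph G" and cubic: "regular 3 G" and k_pos: "k \<ge> 1"
    and choice: "S_choice G f p"
begin

abbreviation H where "H \<equiv> S_graph k G f p"

text \<open>The half of the copy of \<open>Q_graph k\<close> at \<open>e\<close> whose contact
  vertex is assigned to \<open>v\<close>. This reading is valid for an end \<open>v\<close> of
  \<open>e\<close>; a vertex that is not an end of the edge \<open>e\<close> of \<open>G\<close>
  gets the value 2.\<close>

definition side :: "'v \<Rightarrow> 'e \<Rightarrow> nat" where
  "side v e = (if v = f e then 1 else 2)"

lemma assigned_eq: "assigned f v e = QV (side v e) (V 1)"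
  by (simp add: assigned_def side_def)

lemma side_in: "side v e \<in> {1, 2}"
  by (simp add: side_def)

lemma ends_H [simp]:
  "ends H (TEdge v (P, j)) = InT v ` P"
  "ends H (QEdge e (i, d, j)) = InQ e ` q_vertex i ` d"
  "ends H (Join v e x j) = {InT v x, InQ e (QV (side v e) (V 1))}"
  by (simp_all add: S_graph_def T_graph_def Q_graph_def ends_P_graph assigned_eq)

lemma edges_H [simp]:
  "TEdge v (P, j) \<in> edges H \<longleftrightarrow> v \<in> verts G \<and> P \<in> T_pairs \<and> j < k"
  "QEdge e (i, d, j) \<in> edges H \<longleftrightarrow>
    e \<in> edges G \<and> i \<in> {1, 2} \<and> d \<in> edges petersen - {{U 1, V 1}} \<and> j < mult k d"
  "Join v e x j \<in> edges H \<longleftrightarrow> v \<in> verts G \<and> e \<in> incident G v \<and> x \<in> p v e \<and> j < k"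
  by (auto simp: S_graph_def T_graph_def Q_graph_def ends_P_graph edges_P_graph)

lemma verts_H [simp]:
  "InT v x \<in> verts H \<longleftrightarrow> v \<in> verts G \<and> x \<in> {1, 2, 3}"
  "InQ e y \<in> verts H \<longleftrightarrow> e \<in> edges G \<and> (\<exists>i\<in>{1, 2}. \<exists>x\<in>verts petersen. y = q_vertex i x)"
  by (auto simp: S_graph_def T_graph_def Q_graph_def verts_P_graph)

lemma edges_H_cases [consumes 1, case_names T Q J]:
  assumes "d \<in> edges H"
  obtains v P j where "d = TEdge v (P, j)" | e i a j where "d = QEdge e (i, a, j)"
    | v e x j where "d = Join v e x j"
  by (cases d) auto

lemma p_T_pairs: "v \<in> verts G \<Longrightarrow> e \<in> incident G v \<Longrightarrow> p v e \<in> T_pairs"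
  using choice by (auto simp: S_choice_def bij_betw_def)

lemma T_pairs_props: "P \<in> T_pairs \<Longrightarrow> P \<subseteq> {1, 2, 3} \<and> card P = 2"
  by (auto simp: T_pairs_def)

lemma petersen_ends:
  assumes "d \<in> edges petersen"
  obtains a b where "d = {a, b}" "a \<noteq> b" "a \<in> verts petersen" "b \<in> verts petersen"
  using graph_ends[OF graph_petersen assms] by auto

lemma finite_incident: "finite (incident G v)"
  using graph_G by (auto simp: graph_def incident_def)

lemma finite_edges_petersen: "finite (edges petersen)"
  using graph_petersen by (simp add: graph_def)

lemma graph_H: "graph H"
  unfolding graph_def
proof (intro conjI ballI)
  have "verts H \<subseteq> (\<lambda>(v, x). InT v x) ` (verts G \<times> {1, 2, 3}) \<union>
    (\<lambda>(e, i, x). InQ e (q_vertex i x)) ` (edges G \<times> {1, 2} \<times> verts petersen)"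
    by (auto simp: S_graph_def T_graph_def Q_graph_def verts_P_graph image_iff)
  then show "finite (verts H)"
    by (rule finite_subset) (use graph_G graph_petersen in \<open>auto simp: graph_def\<close>)
  have "edges H \<subseteq> (\<lambda>(v, P, j). TEdge v (P, j)) ` (verts G \<times> T_pairs \<times> {..<k}) \<union>
    (\<lambda>(e, i, q). QEdge e (i, q)) ` (edges G \<times> {1, 2} \<times> (SIGMA d:edges petersen. {..<mult k d})) \<union>
    (\<lambda>(v, e, x, j). Join v e x j) ` (verts G \<times> edges G \<times> {1, 2, 3} \<times> {..<k})"
  proof
    fix d assume d: "d \<in> edges H"
    then show "d \<in> (\<lambda>(v, P, j). TEdge v (P, j)) ` (verts G \<times> T_pairs \<times> {..<k}) \<union>
    (\<lambda>(e, i, q). QEdge e (i, q)) ` (edges G \<times> {1, 2} \<times> (SIGMA d:edges petersen. {..<mult k d})) \<union>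
    (\<lambda>(v, e, x, j). Join v e x j) ` (verts G \<times> edges G \<times> {1, 2, 3} \<times> {..<k})"
    proof (cases rule: edges_H_cases)
      case (J v e x j)
      then have "x \<in> {1, 2, 3}" using d p_T_pairs T_pairs_props by fastforce
      then show ?thesis using d J by (auto simp: image_iff incident_def)
    qed (use d in \<open>auto simp: image_iff\<close>)
  qed
  then show "finite (edges H)"
    by (rule finite_subset) (use graph_G graph_petersen in \<open>auto simp: graph_def T_pairs_def\<close>)
next
  fix d assume d: "d \<in> edges H"
  have "ends H d \<subseteq> verts H \<and> card (ends H d) = 2"
    using d
  proof (cases rule: edges_H_cases)
    case (T v P j)
    then have "P \<in> T_pairs" "v \<in> verts G" using d by auto
    moreover have "card (InT v ` P :: ('v, 'e) svertex set) = card P" by (intro card_image) (auto simp: inj_on_def)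
    moreover have "P \<subseteq> {1, 2, 3}" "card P = 2" using T_pairs_props \<open>P \<in> T_pairs\<close> by blast+
    ultimately show ?thesis using T by (auto simp del: insert_iff)
  next
    case (Q e i a j)
    then have "a \<in> edges petersen" "e \<in> edges G" "i \<in> {1, 2}" using d by auto
    from this(1) obtain x y where "a = {x, y}" "x \<noteq> y" "x \<in> verts petersen" "y \<in> verts petersen"
      by (rule petersen_ends)
    then show ?thesis using Q \<open>e \<in> edges G\<close> \<open>i \<in> {1, 2}\<close> by (auto simp: q_vertex_eq_iff)
  next
    case (J v e x j)
    then have "v \<in> verts G" "e \<in> incident G v" "x \<in> p v e" using d by auto
    moreover from this have "x \<in> {1, 2, 3}" using p_T_pairs T_pairs_props by fastforce
    moreover have "V 1 \<in> verts petersen" by (simp add: verts_petersen)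
    ultimately show ?thesis using J side_in[of v e]
      by (auto simp: incident_def intro!: bexI[of _ "side v e"] bexI[of _ "V 1"])
  qed
  then show "ends H d \<subseteq> verts H" "card (ends H d) = 2" by auto
qed

lemma finite_boundary: "finite (boundary H S)"
  using graph_H by (auto simp: graph_def boundary_def)

section \<open>Cuts inside one half of a copy of \<open>Q_graph k\<close>\<close>

definition q_cut :: "'e \<Rightarrow> nat \<Rightarrow> ('v, 'e) svertex set \<Rightarrow> ('v, 'e) sedge set" where
  "q_cut e i S = {d \<in> boundary H S. \<exists>q. d = QEdge e (i, q)}"

lemma sum_petersen:
  "(\<Sum>d\<in>edges petersen - {{U 1, V 1}}. g d) =
    g {V 1, V 2} + g {V 2, V 3} + g {V 3, V 4} + g {V 4, V 5} + g {V 5, V 1} +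
    g {U 1, U 3} + g {U 3, U 5} + g {U 5, U 2} + g {U 2, U 4} + g {U 4, U 1} +
    g {U 2, V 2} + g {U 3, V 3} + g {U 4, V 4} + (g {U 5, V 5} :: nat)"
proof -
  have "edges petersen - {{U 1, V 1}} = {{V 1, V 2}, {V 2, V 3}, {V 3, V 4}, {V 4, V 5}, {V 5, V 1},
    {U 1, U 3}, {U 3, U 5}, {U 5, U 2}, {U 2, U 4}, {U 4, U 1}, {U 2, V 2}, {U 3, V 3}, {U 4, V 4}, {U 5, V 5}}"
    unfolding edges_petersen by (simp add: insert_Diff_if doubleton_eq_iff)
  then show ?thesis by (simp add: doubleton_eq_iff)
qed

text \<open>A cut contains all parallel copies of an edge or none, so its size is a sum of
  multiplicities over the two-coloured Petersen graph without \<open>{U 1, V 1}\<close>. The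
  colouring \<open>c\<close> is left to the caller.\<close>

lemma card_q_cut:
  assumes "e \<in> edges G" "i \<in> {1, 2}" and c: "\<And>x. c x \<longleftrightarrow> InQ e (q_vertex i x) \<in> S"
  shows "card (q_cut e i S) =
    k * of_bool (c (V 1) \<noteq> c (V 2)) + (2 * k - 1) * of_bool (c (V 2) \<noteq> c (V 3)) +
    of_bool (c (V 3) \<noteq> c (V 4)) + (2 * k - 1) * of_bool (c (V 4) \<noteq> c (V 5)) +
    k * of_bool (c (V 5) \<noteq> c (V 1)) + k * of_bool (c (U 1) \<noteq> c (U 3)) +
    k * of_bool (c (U 3) \<noteq> c (U 5)) + (2 * k - 1) * of_bool (c (U 5) \<noteq> c (U 2)) +
    k * of_bool (c (U 2) \<noteq> c (U 4)) + k * of_bool (c (U 4) \<noteq> c (U 1)) +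
    (k + 1) * of_bool (c (U 2) \<noteq> c (V 2)) + 2 * k * of_bool (c (U 3) \<noteq> c (V 3)) +
    2 * k * of_bool (c (U 4) \<noteq> c (V 4)) + (k + 1) * of_bool (c (U 5) \<noteq> c (V 5))"
proof -
  let ?E = "edges petersen - {{U 1, V 1}}"
  define cr where "cr d \<longleftrightarrow> card {x \<in> d. c x} = 1" for d
  have cr: "cr {a, b} \<longleftrightarrow> c a \<noteq> c b" if "a \<noteq> b" for a b
    unfolding cr_def by (rule card_Collect_doubleton[OF that])
  \<comment> \<open>Within one half \<open>q_vertex i\<close> is injective, so crossing can be
    decided on the ends in the Petersen graph.\<close>
  have eq: "card (InQ e ` q_vertex i ` d \<inter> S) = 1 \<longleftrightarrow> cr d" for d
  proof -
    have "InQ e ` q_vertex i ` d \<inter> S = (\<lambda>x. InQ e (q_vertex i x)) ` {x \<in> d. c x}"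
      using c by auto
    then show ?thesis by (simp add: cr_def card_image inj_on_def q_vertex_eq_iff)
  qed
  have mem: "QEdge e (i, d, j) \<in> boundary H S \<longleftrightarrow>
      d \<in> ?E \<and> cr d \<and> j < mult k d" for d j
    unfolding boundary_def mem_Collect_eq edges_H ends_H eq using assms(1,2) by blast
  have "q_cut e i S = (\<lambda>(d, j). QEdge e (i, d, j)) `
    (SIGMA d:{d \<in> ?E. cr d}. {..<mult k d})" (is "_ = _ ` ?D")
  proof (rule set_eqI)
    fix q
    have "q \<in> q_cut e i S \<longleftrightarrow> (\<exists>d j. q = QEdge e (i, d, j) \<and> QEdge e (i, d, j) \<in> boundary H S)"
      unfolding q_cut_def by auto
    also have "\<dots> \<longleftrightarrow> q \<in> (\<lambda>(d, j). QEdge e (i, d, j)) ` ?D"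
      unfolding mem by (force simp del: Diff_iff)
    finally show "q \<in> q_cut e i S \<longleftrightarrow> q \<in> (\<lambda>(d, j). QEdge e (i, d, j)) ` ?D" .
  qed
  moreover have "inj_on (\<lambda>(d, j). QEdge e (i, d, j) :: ('v, 'e) sedge) ?D" by (auto simp: inj_on_def)
  ultimately have "card (q_cut e i S) = card ?D" by (simp only: card_image)
  also have "\<dots> = (\<Sum>d\<in>{d \<in> ?E. cr d}. mult k d)"
    using finite_edges_petersen by simp
  also have "\<dots> = (\<Sum>d\<in>?E. if cr d then mult k d else 0)"
    using finite_edges_petersen by (simp only: sum.inter_filter finite_Diff)
  also have "\<dots> = k * of_bool (c (V 1) \<noteq> c (V 2)) + (2 * k - 1) * of_bool (c (V 2) \<noteq> c (V 3)) +
    of_bool (c (V 3) \<noteq> c (V 4)) + (2 * k - 1) * of_bool (c (V 4) \<noteq> c (V 5)) +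
    k * of_bool (c (V 5) \<noteq> c (V 1)) + k * of_bool (c (U 1) \<noteq> c (U 3)) +
    k * of_bool (c (U 3) \<noteq> c (U 5)) + (2 * k - 1) * of_bool (c (U 5) \<noteq> c (U 2)) +
    k * of_bool (c (U 2) \<noteq> c (U 4)) + k * of_bool (c (U 4) \<noteq> c (U 1)) +
    (k + 1) * of_bool (c (U 2) \<noteq> c (V 2)) + 2 * k * of_bool (c (U 3) \<noteq> c (V 3)) +
    2 * k * of_bool (c (U 4) \<noteq> c (V 4)) + (k + 1) * of_bool (c (U 5) \<noteq> c (V 5))"
    unfolding sum_petersen mult_simps[OF k_pos] by (simp add: cr of_bool_def)
  finally show ?thesis .
qed

text \<open>With \<open>k = Suc m\<close> the cut has \<open>m * X + Y\<close> edges. The check over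
  all colourings gives \<open>r \<le> X\<close> and \<open>r \<le> Y\<close> independently of
  \<open>k\<close>, hence \<open>r * k\<close> edges for every \<open>k\<close>.\<close>

lemma q_cut_bounds:
  fixes S :: "('v, 'e) svertex set"
  assumes "e \<in> edges G" "i \<in> {1, 2}"
  defines "c \<equiv> \<lambda>x. InQ e (q_vertex i x) \<in> S"
  shows "c (V 1) \<noteq> c (U 1) \<Longrightarrow> 2 * k \<le> card (q_cut e i S)"
    and "c (V 1) = c (U 1) \<Longrightarrow> x \<in> verts petersen \<Longrightarrow> c x \<noteq> c (U 1) \<Longrightarrow> 4 * k \<le> card (q_cut e i S)"
proof -
  obtain m where m: "k = Suc m" using k_pos by (cases k) auto
  define r :: nat where "r = (if c (V 1) = c (U 1) then (if c (V 2) = c (U 1) \<and> c (V 3) = c (U 1) \<and> c (V 4) = c (U 1) \<and> c (V 5) = c (U 1)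
    \<and> c (U 2) = c (U 1) \<and> c (U 3) = c (U 1) \<and> c (U 4) = c (U 1) \<and> c (U 5) = c (U 1) then 0 else 4) else 2)"
  define X :: nat where "X = of_bool (c (V 1) \<noteq> c (V 2)) + 2 * of_bool (c (V 2) \<noteq> c (V 3)) + 2 * of_bool (c (V 4) \<noteq> c (V 5)) + of_bool (c (V 5) \<noteq> c (V 1))
   + of_bool (c (U 1) \<noteq> c (U 3)) + of_bool (c (U 3) \<noteq> c (U 5)) + 2 * of_bool (c (U 5) \<noteq> c (U 2)) + of_bool (c (U 2) \<noteq> c (U 4)) + of_bool (c (U 4) \<noteq> c (U 1))
   + of_bool (c (U 2) \<noteq> c (V 2)) + 2 * of_bool (c (U 3) \<noteq> c (V 3)) + 2 * of_bool (c (U 4) \<noteq> c (V 4)) + of_bool (c (U 5) \<noteq> c (V 5))"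
  define Y :: nat where "Y = of_bool (c (V 1) \<noteq> c (V 2)) + of_bool (c (V 2) \<noteq> c (V 3)) + of_bool (c (V 3) \<noteq> c (V 4)) + of_bool (c (V 4) \<noteq> c (V 5)) + of_bool (c (V 5) \<noteq> c (V 1))
   + of_bool (c (U 1) \<noteq> c (U 3)) + of_bool (c (U 3) \<noteq> c (U 5)) + of_bool (c (U 5) \<noteq> c (U 2)) + of_bool (c (U 2) \<noteq> c (U 4)) + of_bool (c (U 4) \<noteq> c (U 1))
   + 2 * of_bool (c (U 2) \<noteq> c (V 2)) + 2 * of_bool (c (U 3) \<noteq> c (V 3)) + 2 * of_bool (c (U 4) \<noteq> c (V 4)) + 2 * of_bool (c (U 5) \<noteq> c (V 5))"
  \<comment> \<open>The instantiation follows the order of first occurrence in the inequality, where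
    \<open>u1\<close> comes right after \<open>v1\<close>.\<close>
  have "r \<le> X \<and> r \<le> Y"
    using split_weights[unfolded Let_def, rule_format, of "c (V 1)" "c (U 1)" "c (V 2)" "c (V 3)"
      "c (V 4)" "c (V 5)" "c (U 2)" "c (U 3)" "c (U 4)" "c (U 5)"]
    unfolding r_def X_def Y_def by assumption
  then have "r \<le> X" "r \<le> Y" by simp_all
  then have "m * r + r \<le> m * X + Y" by (intro add_mono mult_le_mono2)
  also have "m * X + Y = card (q_cut e i S)"
    using card_q_cut[OF assms(1,2), of c S] unfolding X_def Y_def m
    by (simp add: c_def algebra_simps)
  finally have *: "r * k \<le> card (q_cut e i S)" by (simp add: m algebra_simps)
  show "c (V 1) \<noteq> c (U 1) \<Longrightarrow> 2 * k \<le> card (q_cut e i S)" using * by (simp add: r_def)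
  show "c (V 1) = c (U 1) \<Longrightarrow> x \<in> verts petersen \<Longrightarrow> c x \<noteq> c (U 1) \<Longrightarrow> 4 * k \<le> card (q_cut e i S)"
  proof -
    assume "c (V 1) = c (U 1)" "x \<in> verts petersen" "c x \<noteq> c (U 1)"
    then have "r = 4" unfolding r_def verts_petersen by auto
    then show "4 * k \<le> card (q_cut e i S)" using * by simp
  qed
qed

end

section \<open>Small cuts are trivial\<close>

context S_construction
begin

text \<open>The triangle edges on the pair \<open>P\<close> are grouped with the joins of the
  contact vertex attached to \<open>P\<close>: together these are two routes of \<open>k\<close>
  edges between the vertices of \<open>P\<close>. Groups of different pairs are disjoint.\<close>

definition t_cut :: "'v \<Rightarrow> nat set \<Rightarrow> ('v, 'e) svertex set \<Rightarrow> ('v, 'e) sedge set" where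
  "t_cut v P S = {d \<in> boundary H S.
    (\<exists>j. d = TEdge v (P, j)) \<or> (\<exists>e x j. d = Join v e x j \<and> p v e = P)}"

definition j_cut :: "'v \<Rightarrow> 'e \<Rightarrow> ('v, 'e) svertex set \<Rightarrow> ('v, 'e) sedge set" where
  "j_cut v e S = {d \<in> boundary H S. \<exists>x j. d = Join v e x j}"

lemma TEdge_boundary:
  assumes "v \<in> verts G" "{x, y} \<in> T_pairs" "j < k" "x \<noteq> y" "InT v x \<in> S \<longleftrightarrow> InT v y \<notin> S"
  shows "TEdge v ({x, y}, j) \<in> boundary H S"
proof -
  have "card ({InT v x, InT v y} \<inter> S) = 1"
    using assms by (subst card_doubleton_Int) auto
  then show ?thesis using assms by (simp add: boundary_def)
qed

lemma Join_boundary: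
  assumes "v \<in> verts G" "e \<in> incident G v" "x \<in> p v e" "j < k"
    "InT v x \<in> S \<longleftrightarrow> InQ e (QV (side v e) (V 1)) \<notin> S"
  shows "Join v e x j \<in> boundary H S"
proof -
  have "card ({InT v x, InQ e (QV (side v e) (V 1))} \<inter> S) = 1"
    using assms by (subst card_doubleton_Int) auto
  then show ?thesis using assms by (simp add: boundary_def)
qed

lemma incident_of_pair:
  assumes "v \<in> verts G" "P \<in> T_pairs"
  obtains e where "e \<in> incident G v" "p v e = P"
proof -
  have "P \<in> p v ` incident G v" using assms choice by (simp add: S_choice_def bij_betw_def)
  then show thesis using that by blast
qed

text \<open>The \<open>k\<close> triangle edges on \<open>P\<close> cross the cut. The contact
  vertex attached to \<open>P\<close> is on the opposite side from \<open>x\<close> or from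
  \<open>y\<close>, and the \<open>k\<close> joins to that vertex cross as well.\<close>

lemma t_cut_bound:
  assumes v: "v \<in> verts G" and P: "P \<in> T_pairs" and x: "x \<in> P" "InT v x \<in> S" and y: "y \<in> P" "InT v y \<notin> S"
  shows "2 * k \<le> card (t_cut v P S)"
proof -
  have xy: "x \<noteq> y" using x y by auto
  have "card P = 2" using T_pairs_props[OF P] by simp
  then obtain a b where "P = {a, b}" unfolding card_2_iff by blast
  then have P_eq: "P = {x, y}" using x(1) y(1) xy by blast
  obtain e where e: "e \<in> incident G v" "p v e = P" using incident_of_pair[OF v P] .
  obtain z where z: "z \<in> P" "InT v z \<in> S \<longleftrightarrow> InQ e (QV (side v e) (V 1)) \<notin> S"
    using x y by blast
  let ?T = "(\<lambda>j. TEdge v (P, j) :: ('v, 'e) sedge) ` {..<k}" and ?J = "(\<lambda>j. Join v e z j :: ('v, 'e) sedge) ` {..<k}"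
  have "?T \<subseteq> t_cut v P S"
    using TEdge_boundary[OF v, of x y _ S] P x(2) y(2) xy unfolding P_eq t_cut_def by blast
  moreover have "?J \<subseteq> t_cut v P S"
    using Join_boundary[OF v e(1), of z _ S] z e(2) unfolding t_cut_def by blast
  ultimately have "?T \<union> ?J \<subseteq> t_cut v P S" by blast
  moreover have "finite (t_cut v P S)" using finite_boundary by (simp add: t_cut_def)
  ultimately have "card (?T \<union> ?J) \<le> card (t_cut v P S)" by (rule card_mono[rotated])
  moreover have "card (?T \<union> ?J) = card ?T + card ?J" by (rule card_Un_disjoint) auto
  moreover have "card ?T = k" "card ?J = k" by (simp_all add: card_image inj_on_def)
  ultimately show ?thesis by simp
qed

lemma j_cut_bound:
  assumes v: "v \<in> verts G" and e: "e \<in> incident G v"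
    and "\<And>x. x \<in> {1, 2, 3} \<Longrightarrow> InT v x \<in> S \<longleftrightarrow> InQ e (QV (side v e) (V 1)) \<notin> S"
  shows "2 * k \<le> card (j_cut v e S)"
proof -
  let ?J = "(\<lambda>(x, j). Join v e x j :: ('v, 'e) sedge) ` (p v e \<times> {..<k})"
  have p: "p v e \<subseteq> {1, 2, 3}" "card (p v e) = 2"
    using T_pairs_props[OF p_T_pairs[OF v e]] by auto
  have "Join v e x j \<in> boundary H S" if "x \<in> p v e" "j < k" for x j
    using Join_boundary[OF v e that] assms(3)[of x] p(1) that(1) by blast
  then have "?J \<subseteq> j_cut v e S" unfolding j_cut_def by auto
  moreover have "finite (j_cut v e S)" using finite_boundary by (simp add: j_cut_def)
  ultimately have "card ?J \<le> card (j_cut v e S)" by (rule card_mono[rotated])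
  moreover have "card ?J = 2 * k"
    using p(2) by (subst card_image) (simp_all add: inj_on_def card_cartesian_product)
  ultimately show ?thesis by simp
qed

lemma two_packs:
  assumes "A \<subseteq> boundary H S" "B \<subseteq> boundary H S" "A \<inter> B = {}" "2 * k \<le> card A" "2 * k \<le> card B"
  shows "4 * k \<le> card (boundary H S)"
proof -
  have "finite A" "finite B" using assms finite_boundary by (auto intro: finite_subset)
  then have "card (A \<union> B) = card A + card B" using assms(3) by (intro card_Un_disjoint)
  moreover have "card (A \<union> B) \<le> card (boundary H S)"
    using assms(1,2) finite_boundary by (intro card_mono) auto
  ultimately show ?thesis using assms(4,5) by linarith
qed

text \<open>A nontrivial split of three vertices separates two of the three pairs, and their
  disjoint groups have \<open>2 * k\<close> crossing edges each.\<close>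

lemma small_cut_triangle:
  assumes small: "card (boundary H S) < 4 * k" and v: "v \<in> verts G" and "x \<in> {1, 2, 3}"
  shows "InT v x \<in> S \<longleftrightarrow> InT v 1 \<in> S"
proof -
  have split: "2 * k \<le> card (t_cut v {a, b} S)"
    if "(InT v a \<in> S) \<noteq> (InT v b \<in> S)" "{a, b} \<in> T_pairs" for a b
    using that t_cut_bound[OF v that(2), of a S b] t_cut_bound[OF v that(2), of b S a] by blast
  have disj: "\<not> (2 * k \<le> card (t_cut v P S) \<and> 2 * k \<le> card (t_cut v P' S))" if "P \<noteq> P'" for P P'
  proof
    assume "2 * k \<le> card (t_cut v P S) \<and> 2 * k \<le> card (t_cut v P' S)"
    then have "4 * k \<le> card (boundary H S)"
      by (intro two_packs[of "t_cut v P S" _ "t_cut v P' S"]) (use that in \<open>auto simp: t_cut_def\<close>)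
    with small show False by simp
  qed
  have P: "{1, 2} \<in> T_pairs" "{2, 3} \<in> T_pairs" "{3, 1} \<in> T_pairs" by (auto simp: T_pairs_def)
  have ne: "{1, 2} \<noteq> {2, 3 :: nat}" "{2, 3} \<noteq> {3, 1 :: nat}" "{1, 2} \<noteq> {3, 1 :: nat}"
    by (simp_all add: doubleton_eq_iff)
  show ?thesis
    using assms(3) split[OF _ P(1)] split[OF _ P(2)] split[OF _ P(3)]
      disj[OF ne(1)] disj[OF ne(2)] disj[OF ne(3)] by blast
qed

text \<open>Every cut with fewer than \<open>4 k\<close> edges is trivial inside each triangle and inside each half of
  each copy of \<open>Q_graph k\<close> whose two contact vertices agree, so that the graph acts
  as a subdivision of \<open>G\<close> into links of weight \<open>2 k\<close>: joins \<open>Inl (v, e)\<close> and halves \<open>Inr (e, i)\<close>.\<close>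

fun link_edge :: "'v \<times> 'e + 'e \<times> nat \<Rightarrow> 'e" where
  "link_edge (Inl (v, e)) = e"
| "link_edge (Inr (e, i)) = e"

text \<open>\<open>InT v 1\<close> represents the whole triangle at \<open>v\<close>, which in a
  small cut lies on one side by \<open>small_cut_triangle\<close>.\<close>

fun broken :: "('v, 'e) svertex set \<Rightarrow> 'v \<times> 'e + 'e \<times> nat \<Rightarrow> bool" where
  "broken S (Inl (v, e)) \<longleftrightarrow> v \<in> verts G \<and> e \<in> incident G v \<and>
    (InT v 1 \<in> S) \<noteq> (InQ e (QV (side v e) (V 1)) \<in> S)"
| "broken S (Inr (e, i)) \<longleftrightarrow> e \<in> edges G \<and> i \<in> {1, 2} \<and>
    (InQ e (QV i (V 1)) \<in> S) \<noteq> (InQ e Hub \<in> S)"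

fun link_cut :: "('v, 'e) svertex set \<Rightarrow> 'v \<times> 'e + 'e \<times> nat \<Rightarrow> ('v, 'e) sedge set" where
  "link_cut S (Inl (v, e)) = j_cut v e S"
| "link_cut S (Inr (e, i)) = q_cut e i S"

lemma link_cut_bound:
  assumes small: "card (boundary H S) < 4 * k" and "broken S l"
  shows "2 * k \<le> card (link_cut S l)"
proof (cases l)
  case (Inl a)
  then obtain v e where l: "l = Inl (v, e)" by (cases a) auto
  then have v: "v \<in> verts G" and e: "e \<in> incident G v"
    and b: "(InT v 1 \<in> S) \<noteq> (InQ e (QV (side v e) (V 1)) \<in> S)"
    using assms(2) by auto
  show ?thesis unfolding l link_cut.simps
    by (rule j_cut_bound[OF v e]) (use small_cut_triangle[OF small v] b in blast)
next
  case (Inr a)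
  then obtain e i where l: "l = Inr (e, i)" by (cases a) auto
  then have e: "e \<in> edges G" and i: "i \<in> {1, 2}"
    and b: "(InQ e (QV i (V 1)) \<in> S) \<noteq> (InQ e Hub \<in> S)"
    using assms(2) by auto
  show ?thesis unfolding l link_cut.simps
    by (rule q_cut_bounds(1)[OF e i]) (use b in simp)
qed

text \<open>Different links have disjoint sets of crossing edges, and a broken one has at least
  \<open>2 * k\<close> of them, so two would exceed the cut.\<close>

lemma broken_unique:
  assumes small: "card (boundary H S) < 4 * k" and "broken S l" "broken S l'"
  shows "l = l'"
proof (rule ccontr)
  assume ne: "l \<noteq> l'"
  have "link_cut S l \<subseteq> boundary H S" for l
    by (cases "(S, l)" rule: link_cut.cases) (auto simp: j_cut_def q_cut_def)
  moreover have "link_cut S l \<inter> link_cut S l' = {}"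
    using ne by (cases "(S, l)" rule: link_cut.cases; cases "(S, l')" rule: link_cut.cases)
      (auto simp: j_cut_def q_cut_def)
  ultimately have "4 * k \<le> card (boundary H S)"
    by (intro two_packs[of "link_cut S l" _ "link_cut S l'"] link_cut_bound assms)
  with small show False by simp
qed

section \<open>From a single broken link to trivial cuts\<close>

lemma small_cut_half:
  assumes small: "card (boundary H S) < 4 * k" and e: "e \<in> edges G" and i: "i \<in> {1, 2}"
    and x: "x \<in> verts petersen" and eq: "InQ e (QV i (V 1)) \<in> S \<longleftrightarrow> InQ e Hub \<in> S"
  shows "InQ e (q_vertex i x) \<in> S \<longleftrightarrow> InQ e Hub \<in> S"
proof (rule ccontr)
  assume "\<not> ?thesis"
  then have "4 * k \<le> card (q_cut e i S)"
    using q_cut_bounds(2)[OF e i _ x, of S] eq by simp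
  also have "\<dots> \<le> card (boundary H S)"
    using finite_boundary by (intro card_mono) (auto simp: q_cut_def)
  finally show False using small by simp
qed

lemma incident_side:
  assumes "e \<in> edges G" "ends G e = {v, w}" "v \<noteq> w"
  shows "v \<in> verts G" "w \<in> verts G" "e \<in> incident G v" "e \<in> incident G w"
    "{side v e, side w e} = {1, 2}" "side v e \<noteq> side w e"
proof -
  show "v \<in> verts G" "w \<in> verts G" using assms(1,2) graph_G by (auto simp: graph_def)
  show "e \<in> incident G v" "e \<in> incident G w" using assms by (auto simp: incident_def)
  have "f e = v \<or> f e = w" using choice assms(1,2) by (auto simp: S_choice_def)
  then show "{side v e, side w e} = {1, 2}" "side v e \<noteq> side w e"
    using assms(3) by (auto simp: side_def)
qed

text \<open>At most one link is broken. First all triangles are shown to be on one side, then the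
  contact vertices and hubs, and finally, by \<open>small_cut_half\<close>, all other
  vertices.\<close>

lemma small_cut_trivial:
  assumes conn: "connected G" and bl: "bridgeless G"
    and small: "card (boundary H S) < 4 * k" and S: "S \<subseteq> verts H"
  shows "S = {} \<or> S = verts H"
proof -
  define t where "t v \<longleftrightarrow> InT v 1 \<in> S" for v
  \<comment> \<open>The links over \<open>e\<close> form a path from the triangle at
    \<open>v\<close> through a contact vertex, the hub and the other contact vertex to the triangle
    at \<open>w\<close>; the side must change somewhere along it.\<close>
  have cross: "\<exists>l. broken S l \<and> link_edge l = e"
    if e: "e \<in> edges G" and vw: "ends G e = {v, w}" "t v \<noteq> t w" for e v w
  proof (rule ccontr)
    assume none: "\<nexists>l. broken S l \<and> link_edge l = e"
    have "v \<noteq> w" using vw by auto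
    note side = incident_side[OF e vw(1) this]
    have "\<not> broken S (Inl (v, e))" "\<not> broken S (Inl (w, e))" "\<not> broken S (Inr (e, 1))" "\<not> broken S (Inr (e, 2))"
      using none by (metis link_edge.simps)+
    moreover have "side v e = 1 \<and> side w e = 2 \<or> side v e = 2 \<and> side w e = 1"
      using side(5,6) by (metis doubleton_eq_iff)
    ultimately show False using side e vw(2) by (auto simp: t_def)
  qed
  have same_ends: "t v = t w" if e: "e \<in> edges G" and vw: "ends G e = {v, w}" for e v w
  proof (rule ccontr)
    assume ne: "t v \<noteq> t w"
    \<comment> \<open>Since \<open>e\<close> is not a bridge, its ends are still connected without
      it. A change of side along that walk would occur at another edge \<open>e'\<close>, which
      would give a second broken link.\<close>
    have path: "(v, w) \<in> (adjacency (delete_edges G {e}))\<^sup>*"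
      using bl e vw unfolding bridgeless_def bridge_def by blast
    have preserved: "t x = t y" if xy: "(x, y) \<in> adjacency (delete_edges G {e})" for x y
    proof (rule ccontr)
      assume "t x \<noteq> t y"
      obtain e' where e': "e' \<in> edges G" "e' \<noteq> e" "ends G e' = {x, y}"
        using xy by (auto simp: adjacency_def delete_edges_def)
      obtain l where "broken S l" "link_edge l = e" using cross[OF e vw ne] by blast
      moreover obtain l' where "broken S l'" "link_edge l' = e'"
        using cross[OF e'(1,3) \<open>t x \<noteq> t y\<close>] by blast
      ultimately show False using broken_unique[OF small] e'(2) by blast
    qed
    from path have "t v = t w"
    proof (induction rule: rtrancl_induct)
      case (step y z)
      then show ?case using preserved by metis
    qed simp
    with ne show False by simp
  qed
  obtain v0 where v0: "v0 \<in> verts G" using conn by (auto simp: connected_def)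
  have t_const: "t v = t v0" if "v \<in> verts G" for v
  proof -
    have "(v0, v) \<in> (adjacency G)\<^sup>*" using conn v0 that by (auto simp: connected_def)
    then show ?thesis
    proof (induction rule: rtrancl_induct)
      case (step y z)
      from step.hyps(2) have "t y = t z" using same_ends unfolding adjacency_def by blast
      with step.IH show ?case by simp
    qed simp
  qed
  have Q_const: "(InQ e (QV 1 (V 1)) \<in> S) = t v0 \<and> (InQ e Hub \<in> S) = t v0 \<and> (InQ e (QV 2 (V 1)) \<in> S) = t v0"
    if e: "e \<in> edges G" for e
  proof -
    obtain v w where vw: "ends G e = {v, w}" "v \<noteq> w" using graph_ends[OF graph_G e] by metis
    note side = incident_side[OF e vw]
    have b: "broken S (Inl (v, e)) \<longleftrightarrow> t v0 \<noteq> (InQ e (QV (side v e) (V 1)) \<in> S)"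
      "broken S (Inl (w, e)) \<longleftrightarrow> t v0 \<noteq> (InQ e (QV (side w e) (V 1)) \<in> S)"
      "broken S (Inr (e, 1)) \<longleftrightarrow> (InQ e (QV 1 (V 1)) \<in> S) \<noteq> (InQ e Hub \<in> S)"
      "broken S (Inr (e, 2)) \<longleftrightarrow> (InQ e (QV 2 (V 1)) \<in> S) \<noteq> (InQ e Hub \<in> S)"
      using side(1-4) e t_const[OF side(1)] t_const[OF side(2)] by (simp_all add: t_def)
    have "\<not> (broken S l \<and> broken S l')" if "l \<noteq> l'" for l l'
      using broken_unique[OF small] that by blast
    \<comment> \<open>The path of four links over \<open>e\<close> begins and ends on the same side,
      so the number of changes along it is even. Pairwise exclusion of broken links then leaves no
      change at all.\<close>
    from this[of "Inl (v, e)" "Inl (w, e)"] this[of "Inl (v, e)" "Inr (e, 1)"]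
      this[of "Inl (v, e)" "Inr (e, 2)"] this[of "Inl (w, e)" "Inr (e, 1)"]
      this[of "Inl (w, e)" "Inr (e, 2)"] this[of "Inr (e, 1)" "Inr (e, 2)"]
    have u: "\<not> (broken S (Inl (v, e)) \<and> broken S (Inl (w, e)))"
      "\<not> (broken S (Inl (v, e)) \<and> broken S (Inr (e, 1)))"
      "\<not> (broken S (Inl (v, e)) \<and> broken S (Inr (e, 2)))"
      "\<not> (broken S (Inl (w, e)) \<and> broken S (Inr (e, 1)))"
      "\<not> (broken S (Inl (w, e)) \<and> broken S (Inr (e, 2)))"
      "\<not> (broken S (Inr (e, 1)) \<and> broken S (Inr (e, 2)))"
      using vw(2) by (simp_all del: broken.simps)
    have "side v e = 1 \<and> side w e = 2 \<or> side v e = 2 \<and> side w e = 1"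
      using side(5,6) by (metis doubleton_eq_iff)
    then show ?thesis
    proof (elim disjE conjE)
      assume "side v e = 1" "side w e = 2"
      with u[unfolded b] show ?thesis by (smt (verit))
    next
      assume "side v e = 2" "side w e = 1"
      with u[unfolded b] show ?thesis by (smt (verit))
    qed
  qed
  have "y \<in> S \<longleftrightarrow> t v0" if "y \<in> verts H" for y
  proof (cases y)
    case (InT v x)
    then show ?thesis using that small_cut_triangle[OF small, of v x] t_const[of v] by (auto simp: t_def)
  next
    case (InQ e q)
    with that obtain i x where ix: "e \<in> edges G" "i \<in> {1, 2}" "x \<in> verts petersen" "q = q_vertex i x" by auto
    then have "InQ e (QV i (V 1)) \<in> S \<longleftrightarrow> InQ e Hub \<in> S" using Q_const[OF ix(1)] by auto
    from small_cut_half[OF small ix(1,2,3) this] show ?thesis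
      using Q_const[OF ix(1)] InQ ix(4) by simp
  qed
  then show ?thesis using S by auto
qed

end

section \<open>Degrees and edge connectivity\<close>

context S_construction
begin

lemma q_vertex_ends_iff [simp]:
  "InQ e (q_vertex i x) \<in> ends H (QEdge e' (i', a, j)) \<longleftrightarrow> e' = e \<and> x \<in> a \<and> (x = U 1 \<or> i = i')"
proof -
  have "InQ e (q_vertex i x) \<in> ends H (QEdge e' (i', a, j)) \<longleftrightarrow>
    e' = e \<and> (\<exists>y\<in>a. q_vertex i x = q_vertex i' y)" by auto
  then show ?thesis unfolding q_vertex_eq_iff by blast
qed

text \<open>The degree inside one half, as a singleton cut. The deleted edge
  \<open>{U 1, V 1}\<close> has multiplicity \<open>2 * k\<close> in \<open>P_graph k\<close>, which
  explains the deficit at its two ends.\<close>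

lemma card_q_cut_vertex:
  assumes "e \<in> edges G" "i \<in> {1, 2}" "x \<in> verts petersen"
  shows "card (q_cut e i {InQ e (q_vertex i x)}) = (if x \<in> {U 1, V 1} then 2 * k else 4 * k)"
proof -
  have "y = x \<longleftrightarrow> InQ e (q_vertex i y) \<in> {InQ e (q_vertex i x)}" for y
    by (auto simp: q_vertex_eq_iff)
  note count = card_q_cut[OF assms(1,2), of "\<lambda>y. y = x", OF this]
  have "x = V 1 \<or> x = V 2 \<or> x = V 3 \<or> x = V 4 \<or> x = V 5 \<or> x = U 1 \<or> x = U 2 \<or> x = U 3 \<or> x = U 4 \<or> x = U 5"
    using assms(3) by (simp add: verts_petersen)
  then show ?thesis unfolding count by (elim disjE) (use k_pos in simp_all)
qed

lemma InQ_in_verts: "e \<in> edges G \<Longrightarrow> i \<in> {1, 2} \<Longrightarrow> x \<in> verts petersen \<Longrightarrow> InQ e (q_vertex i x) \<in> verts H"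
  by auto

text \<open>Two of the three pairs contain \<open>x\<close>. As \<open>p v\<close> is a bijection
  onto the pairs, two incident edges of \<open>G\<close> are joined to \<open>x\<close>, so triangle
  edges and joins contribute \<open>2 * k\<close> each.\<close>

lemma card_incident_triangle:
  assumes v: "v \<in> verts G" and x: "x \<in> {1, 2, 3}"
  shows "card (incident H (InT v x)) = 4 * k"
proof -
  let ?P = "{P \<in> T_pairs. x \<in> P}" and ?E = "{e \<in> incident G v. x \<in> p v e}"
  let ?T = "(\<lambda>(P, j). TEdge v (P, j) :: ('v, 'e) sedge) ` (?P \<times> {..<k})"
  let ?J = "(\<lambda>(e, j). Join v e x j :: ('v, 'e) sedge) ` (?E \<times> {..<k})"
  have "bij_betw (p v) (incident G v) T_pairs" using choice v by (simp add: S_choice_def)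
  then have "bij_betw (p v) ?E ?P" unfolding bij_betw_def inj_on_def by blast
  then have "card ?E = card ?P" by (rule bij_betw_same_card)
  moreover have "card ?P = 2"
  proof -
    have "?P = (if x = 1 then {{1, 2}, {3, 1}} else if x = 2 then {{1, 2}, {2, 3}} else {{2, 3}, {3, 1}})"
      using x unfolding T_pairs_def by auto
    then show ?thesis by (simp add: doubleton_eq_iff)
  qed
  moreover have "incident H (InT v x) = ?T \<union> ?J"
  proof (rule set_eqI)
    fix d
    show "d \<in> incident H (InT v x) \<longleftrightarrow> d \<in> ?T \<union> ?J"
    proof (cases "d \<in> edges H")
      case True
      then show ?thesis using v by (cases rule: edges_H_cases) (auto simp: incident_def)
    next
      case False
      moreover have "?T \<union> ?J \<subseteq> edges H" using v by auto
      ultimately show ?thesis by (auto simp: incident_def)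
    qed
  qed
  moreover have "finite ?T" "finite ?J" using finite_incident by (auto simp: T_pairs_def)
  moreover have "?T \<inter> ?J = {}" by auto
  moreover have "card ?T = card ?P * k" by (subst card_image) (simp_all add: inj_on_def card_cartesian_product)
  moreover have "card ?J = card ?E * k" by (subst card_image) (simp_all add: inj_on_def card_cartesian_product)
  ultimately show ?thesis by (simp add: card_Un_disjoint)
qed

lemma side_exists:
  assumes "e \<in> edges G" "i \<in> {1, 2}"
  obtains v where "v \<in> verts G" "e \<in> incident G v" "side v e = i"
    "\<And>v'. e \<in> incident G v' \<Longrightarrow> side v' e = i \<Longrightarrow> v' = v"
proof -
  obtain v w where vw: "ends G e = {v, w}" "v \<noteq> w" using graph_ends[OF graph_G assms(1)] by metis
  note s = incident_side[OF assms(1) vw]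
  have inc: "v' = v \<or> v' = w" if "e \<in> incident G v'" for v'
    using that vw by (simp add: incident_def)
  have "side v e = i \<or> side w e = i" using assms(2) unfolding s(5)[symmetric] by auto
  then show thesis
  proof
    assume "side v e = i" then show thesis using that[of v] s inc by metis
  next
    assume "side w e = i" then show thesis using that[of w] s inc by metis
  qed
qed

text \<open>The deficit of \<open>2 * k\<close> inside the half is made up by the joins to the one
  triangle that this contact vertex is assigned to; \<open>uniq\<close> excludes joins to any
  other.\<close>

lemma card_incident_contact:
  assumes e: "e \<in> edges G" and i: "i \<in> {1, 2}"
  shows "card (incident H (InQ e (QV i (V 1)))) = 4 * k"
proof -
  obtain v where v: "v \<in> verts G" "e \<in> incident G v" "side v e = i"
    and uniq: "\<And>v'. e \<in> incident G v' \<Longrightarrow> side v' e = i \<Longrightarrow> v' = v"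
    using side_exists[OF e i] by metis
  let ?w = "InQ e (q_vertex i (V 1)) :: ('v, 'e) svertex"
  let ?J = "(\<lambda>(x, j). Join v e x j :: ('v, 'e) sedge) ` (p v e \<times> {..<k})"
  have "incident H ?w = q_cut e i {?w} \<union> ?J"
  proof (rule set_eqI)
    fix d
    show "d \<in> incident H ?w \<longleftrightarrow> d \<in> q_cut e i {?w} \<union> ?J"
    proof (cases "d \<in> edges H")
      case True
      then show ?thesis
      proof (cases rule: edges_H_cases)
        case (J v' e' x j)
        have "e' \<in> incident G v'" "x \<in> p v' e'" "j < k" using True J by simp_all
        moreover have "?w \<in> ends H d \<longleftrightarrow> e' = e \<and> side v' e = i" unfolding J by auto
        ultimately have "?w \<in> ends H d \<longleftrightarrow> e' = e \<and> v' = v"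
          using uniq v(3) by blast
        moreover have "d \<in> ?J \<longleftrightarrow> v' = v \<and> e' = e"
          using \<open>x \<in> p v' e'\<close> \<open>j < k\<close> unfolding J by auto
        moreover have "d \<notin> q_cut e i {?w}" unfolding J q_cut_def by simp
        ultimately show ?thesis using True unfolding incident_def by blast
      next
        case (Q e' i' a j)
        then show ?thesis using True unfolding q_cut_def boundary_singleton[OF graph_H]
          by (auto simp: incident_def simp del: q_vertex_simps ends_H)
      qed (auto simp: incident_def q_cut_def)
    next
      case False
      moreover have "?J \<subseteq> edges H" using v by auto
      ultimately show ?thesis by (auto simp: incident_def q_cut_def boundary_def)
    qed
  qed
  moreover have "finite ?J" "card (p v e) = 2"
    using T_pairs_props[OF p_T_pairs[OF v(1,2)]] by (auto intro!: finite_cartesian_product finite_imageI intro: finite_subset)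
  moreover have "finite (q_cut e i {?w})" using finite_boundary by (simp add: q_cut_def)
  moreover have "q_cut e i {?w} \<inter> ?J = {}" by (auto simp: q_cut_def)
  moreover have "card ?J = card (p v e) * k" by (subst card_image) (simp_all add: inj_on_def card_cartesian_product)
  moreover have "card (q_cut e i {?w}) = 2 * k"
    using card_q_cut_vertex[OF e i, of "V 1"] by (simp add: verts_petersen)
  ultimately show ?thesis by (simp add: card_Un_disjoint)
qed

lemma card_incident_hub:
  assumes e: "e \<in> edges G"
  shows "card (incident H (InQ e Hub)) = 4 * k"
proof -
  let ?w = "InQ e Hub :: ('v, 'e) svertex"
  have "incident H ?w = q_cut e 1 {?w} \<union> q_cut e 2 {?w}"
  proof (rule set_eqI)
    fix d
    show "d \<in> incident H ?w \<longleftrightarrow> d \<in> q_cut e 1 {?w} \<union> q_cut e 2 {?w}"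
    proof (cases "d \<in> edges H")
      case True
      then show ?thesis
      proof (cases rule: edges_H_cases)
        case (Q e' i' a j)
        then show ?thesis using True q_vertex_ends_iff[of e 1 "U 1" e' i' a j]
          unfolding q_cut_def boundary_singleton[OF graph_H]
          by (auto simp: incident_def simp del: ends_H)
      qed (auto simp: incident_def q_cut_def)
    qed (auto simp: incident_def q_cut_def boundary_def)
  qed
  moreover have "finite (q_cut e i {?w})" for i using finite_boundary by (simp add: q_cut_def)
  moreover have "q_cut e 1 {?w} \<inter> q_cut e 2 {?w} = {}" by (auto simp: q_cut_def)
  moreover have "card (q_cut e i {?w}) = 2 * k" if "i \<in> {1, 2}" for i
    using card_q_cut_vertex[OF e that, of "U 1"] by (simp add: verts_petersen)
  ultimately show ?thesis by (simp add: card_Un_disjoint)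
qed

lemma card_incident_inner:
  assumes e: "e \<in> edges G" and i: "i \<in> {1, 2}" and x: "x \<in> verts petersen" "x \<noteq> U 1" "x \<noteq> V 1"
  shows "card (incident H (InQ e (q_vertex i x))) = 4 * k"
proof -
  let ?w = "InQ e (q_vertex i x) :: ('v, 'e) svertex"
  have ne: "q_vertex i x \<noteq> QV i' (V 1)" for i' using x(2,3) by (simp add: q_vertex_def)
  have "incident H ?w = q_cut e i {?w}"
  proof (rule set_eqI)
    fix d
    show "d \<in> incident H ?w \<longleftrightarrow> d \<in> q_cut e i {?w}"
    proof (cases "d \<in> edges H")
      case True
      then show ?thesis
      proof (cases rule: edges_H_cases)
        case (Q e' i' a j)
        then show ?thesis using True x(2) unfolding q_cut_def boundary_singleton[OF graph_H]
          by (auto simp: incident_def simp del: ends_H)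
      qed (use ne in \<open>auto simp: incident_def q_cut_def\<close>)
    qed (auto simp: incident_def q_cut_def boundary_def)
  qed
  then show ?thesis using card_q_cut_vertex[OF e i x(1)] x by simp
qed

lemma regular_H: "regular (4 * k) H"
  unfolding regular_def
proof
  fix y assume y: "y \<in> verts H"
  show "card (incident H y) = 4 * k"
  proof (cases y)
    case (InT v x)
    with y show ?thesis using card_incident_triangle by auto
  next
    case (InQ e q)
    with y obtain i x where ix: "e \<in> edges G" "i \<in> {1, 2}" "x \<in> verts petersen" "q = q_vertex i x" by auto
    then show ?thesis
      using card_incident_hub[OF ix(1)] card_incident_contact[OF ix(1,2)] card_incident_inner[OF ix(1-3)] InQ
      by (cases "x = U 1"; cases "x = V 1") simp_all
  qed
qed

section \<open>Parity of the number of vertices, edge connectivity and odd cuts\<close>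

lemma even_card_verts_H:
  assumes "even (card (edges G))"
  shows "even (card (verts H))"
proof -
  let ?T = "(\<lambda>(v, x). InT v x :: ('v, 'e) svertex) ` (verts G \<times> {1, 2, 3})"
  let ?Q = "(\<lambda>(e, y). InQ e y :: ('v, 'e) svertex) ` (edges G \<times> verts (Q_graph k))"
  have "verts H = ?T \<union> ?Q" by (auto simp: S_graph_def T_graph_def)
  moreover have "finite (verts H)" using graph_H by (simp add: graph_def)
  moreover have "?T \<inter> ?Q = {}" by auto
  ultimately have "card (verts H) = card ?T + card ?Q" by (simp add: card_Un_disjoint)
  moreover have "card ?T = 3 * card (verts G)"
    by (subst card_image) (simp_all add: inj_on_def card_cartesian_product)
  moreover have "card ?Q = card (edges G) * card (verts (Q_graph k))"
    by (subst card_image) (simp_all add: inj_on_def card_cartesian_product)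
  moreover have "even (card (verts G))"
  proof -
    have "3 * card (verts G) = 2 * card (edges G)" using handshake[OF graph_G cubic] .
    then have "even (3 * card (verts G))" by simp
    then show ?thesis by simp
  qed
  ultimately show ?thesis using assms by simp
qed

lemma card_verts_H:
  assumes "verts G \<noteq> {}"
  shows "1 < card (verts H)"
proof -
  obtain v where v: "v \<in> verts G" using assms by auto
  then have "{InT v 1, InT v 2} \<subseteq> verts H" by auto
  moreover have "finite (verts H)" using graph_H by (simp add: graph_def)
  ultimately have "card {InT v 1, InT v 2 :: ('v, 'e) svertex} \<le> card (verts H)" by (rule card_mono[rotated])
  then show ?thesis by simp
qed

lemma cut_bound:
  assumes "connected G" "bridgeless G" "S \<subseteq> verts H" "S \<noteq> {}" "S \<noteq> verts H"
  shows "4 * k \<le> card (boundary H S)"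
  using small_cut_trivial[OF assms(1,2) _ assms(3)] assms(4,5) by (meson not_le)

lemma edge_connected_H:
  assumes "connected G" "bridgeless G"
  shows "edge_connected (4 * k) H"
  using assms cut_bound card_verts_H by (intro edge_connectedI graph_H) (auto simp: connected_def)

lemma r_graph_H:
  assumes "connected G" "bridgeless G" "even (card (edges G))"
  shows "r_graph (4 * k) H"
  unfolding r_graph_def
proof (intro conjI allI impI graph_H regular_H)
  \<comment> \<open>An odd set is nonempty, and it is not all of \<open>verts H\<close>, which has
    even size; so the bound for nontrivial cuts applies.\<close>
  fix S assume "S \<subseteq> verts H" "odd (card S)"
  then show "4 * k \<le> card (boundary H S)"
    using even_card_verts_H[OF assms(3)] by (intro cut_bound assms(1,2)) auto
qed

end

section \<open>Disjoint perfect matchings\<close>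

context S_construction
begin

text \<open>The trace of \<open>M\<close> on a half, as a set of Petersen edges. Forgetting the copy
  index merges nothing when \<open>M\<close> is a perfect matching, since parallel edges share their
  ends.\<close>

definition inner :: "('v, 'e) sedge set \<Rightarrow> 'e \<Rightarrow> nat \<Rightarrow> pvertex set set" where
  "inner M e i = {d. \<exists>j. QEdge e (i, d, j) \<in> M}"

definition uses :: "('v, 'e) sedge set \<Rightarrow> 'e \<Rightarrow> nat \<Rightarrow> pvertex \<Rightarrow> bool" where
  "uses M e i x \<longleftrightarrow> (\<exists>d\<in>inner M e i. x \<in> d)"

definition joined :: "('v, 'e) sedge set \<Rightarrow> 'v \<Rightarrow> 'e \<Rightarrow> bool" where
  "joined M v e \<longleftrightarrow> (\<exists>x j. Join v e x j \<in> M)"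

lemma inner_subset:
  assumes "perfect_matching H M"
  shows "inner M e i \<subseteq> edges petersen - {{U 1, V 1}}"
proof
  fix d assume "d \<in> inner M e i"
  then obtain j where "QEdge e (i, d, j) \<in> edges H"
    using assms by (auto simp: inner_def perfect_matching_def simp del: edges_H)
  then show "d \<in> edges petersen - {{U 1, V 1}}" by simp
qed

lemma inner_unique:
  assumes M: "perfect_matching H M" and "e \<in> edges G" "i \<in> {1, 2}" "x \<in> verts petersen"
    and "d \<in> inner M e i" "d' \<in> inner M e i" "x \<in> d" "x \<in> d'"
  shows "d = d'"
proof -
  obtain j j' where "QEdge e (i, d, j) \<in> M" "QEdge e (i, d', j') \<in> M"
    using assms(5,6) by (auto simp: inner_def)
  moreover have "InQ e (q_vertex i x) \<in> ends H (QEdge e (i, d, j))"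
    "InQ e (q_vertex i x) \<in> ends H (QEdge e (i, d', j'))"
    using assms(7,8) by (simp_all del: ends_H)
  ultimately have "QEdge e (i, d, j) = (QEdge e (i, d', j') :: ('v, 'e) sedge)"
    using perfect_matching_unique[OF M InQ_in_verts[OF assms(2-4)]] by blast
  then show ?thesis by simp
qed

lemma inner_ex1:
  assumes M: "perfect_matching H M" and e: "e \<in> edges G" "i \<in> {1, 2}"
    and x: "x \<in> verts petersen" "x \<noteq> U 1" "x \<noteq> V 1"
  shows "\<exists>!d. d \<in> inner M e i \<and> x \<in> d"
proof (rule ex_ex1I)
  obtain d where d: "d \<in> M" "d \<in> edges H" "InQ e (q_vertex i x) \<in> ends H d"
    using perfect_matching_covers[OF M InQ_in_verts[OF e x(1)]] .
  from d(2) show "\<exists>d. d \<in> inner M e i \<and> x \<in> d"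
  proof (cases rule: edges_H_cases)
    case (Q e' i' a j)
    then have "e' = e" "i' = i" "x \<in> a" using d(3) x(2) by (simp_all del: ends_H)
    then show ?thesis using d(1) Q by (auto simp: inner_def)
  qed (use d(3) x in \<open>auto simp: q_vertex_def\<close>)
qed (use inner_unique[OF M e x(1)] in blast)

text \<open>All edges at the eight vertices other than \<open>V 1\<close> and \<open>U 1\<close>
  stay inside the half, so the trace covers each of them exactly once. It covers \<open>V 1\<close>
  and \<open>U 1\<close> at most once and avoids the deleted edge, which is the situation of
  \<open>near_matching\<close>.\<close>

lemma inner_pattern:
  assumes M: "perfect_matching H M" and e: "e \<in> edges G" "i \<in> {1, 2}"
  defines "N \<equiv> inner M e i"
  shows "uses M e i (V 1) \<longleftrightarrow> {V 1, V 2} \<in> N \<or> {V 5, V 1} \<in> N"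
    "uses M e i (U 1) \<longleftrightarrow> {U 1, U 3} \<in> N \<or> {U 4, U 1} \<in> N"
    "uses M e i (V 1) \<longleftrightarrow> uses M e i (U 1)"
    "uses M e i (V 1) \<Longrightarrow> if ({V 1, V 2} \<in> N) = ({U 1, U 3} \<in> N) then {V 3, V 4} \<in> N else {U 5, U 2} \<in> N"
proof -
  have N: "N \<subseteq> edges petersen" "{U 1, V 1} \<notin> N" using inner_subset[OF M, of e i] unfolding N_def by blast+
  have inc: "x \<in> d \<longleftrightarrow> d \<in> incident petersen x" if "d \<in> N" for d x
    using N(1) that by (auto simp: incident_def)
  have V1: "d \<in> N \<and> V 1 \<in> d \<longleftrightarrow> d \<in> N \<and> (d = {V 1, V 2} \<or> d = {V 5, V 1})" for d
    using inc[of d "V 1"] N(2) unfolding incident_petersen by blast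
  have U1: "d \<in> N \<and> U 1 \<in> d \<longleftrightarrow> d \<in> N \<and> (d = {U 1, U 3} \<or> d = {U 4, U 1})" for d
    using inc[of d "U 1"] N(2) unfolding incident_petersen by blast
  show uV: "uses M e i (V 1) \<longleftrightarrow> {V 1, V 2} \<in> N \<or> {V 5, V 1} \<in> N"
    by (simp only: uses_def N_def[symmetric] Bex_def V1) blast
  show uU: "uses M e i (U 1) \<longleftrightarrow> {U 1, U 3} \<in> N \<or> {U 4, U 1} \<in> N"
    by (simp only: uses_def N_def[symmetric] Bex_def U1) blast
  have x: "V 1 \<in> verts petersen" "U 1 \<in> verts petersen" by (simp_all add: verts_petersen)
  have "\<not> ({V 1, V 2} \<in> N \<and> {V 5, V 1} \<in> N)"
    using inner_unique[OF M e x(1), folded N_def, of "{V 1, V 2}" "{V 5, V 1}"]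
    by (force simp: doubleton_eq_iff)
  moreover have "\<not> ({U 1, U 3} \<in> N \<and> {U 4, U 1} \<in> N)"
    using inner_unique[OF M e x(2), folded N_def, of "{U 1, U 3}" "{U 4, U 1}"]
    by (force simp: doubleton_eq_iff)
  moreover have "\<exists>!d. d \<in> N \<and> V n \<in> d" "\<exists>!d. d \<in> N \<and> U n \<in> d" if "n \<in> {2, 3, 4, 5}" for n
    by (rule inner_ex1[OF M e, folded N_def]; use that in \<open>auto simp: verts_petersen\<close>)+
  note ex1 = this
  have "one3 ({V 1, V 2} \<in> N) ({V 2, V 3} \<in> N) ({U 2, V 2} \<in> N)"
    "one3 ({V 2, V 3} \<in> N) ({V 3, V 4} \<in> N) ({U 3, V 3} \<in> N)"
    "one3 ({V 3, V 4} \<in> N) ({V 4, V 5} \<in> N) ({U 4, V 4} \<in> N)"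
    "one3 ({V 4, V 5} \<in> N) ({V 5, V 1} \<in> N) ({U 5, V 5} \<in> N)"
    "one3 ({U 5, U 2} \<in> N) ({U 2, U 4} \<in> N) ({U 2, V 2} \<in> N)"
    "one3 ({U 1, U 3} \<in> N) ({U 3, U 5} \<in> N) ({U 3, V 3} \<in> N)"
    "one3 ({U 2, U 4} \<in> N) ({U 4, U 1} \<in> N) ({U 4, V 4} \<in> N)"
    "one3 ({U 3, U 5} \<in> N) ({U 5, U 2} \<in> N) ({U 5, V 5} \<in> N)"
    unfolding ex1_petersen[OF N(1), symmetric] by (simp_all add: ex1)
  \<comment> \<open>\<open>calculation\<close> still holds the two facts that at most one trace edge
    meets \<open>V 1\<close> and at most one meets \<open>U 1\<close>.\<close>
  note near = near_matching[OF this calculation]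
  show "uses M e i (V 1) \<longleftrightarrow> uses M e i (U 1)" using near(1) unfolding uV uU .
  show "uses M e i (V 1) \<Longrightarrow> if ({V 1, V 2} \<in> N) = ({U 1, U 3} \<in> N) then {V 3, V 4} \<in> N else {U 5, U 2} \<in> N"
    unfolding uV by (rule near(2))
qed

text \<open>The hub is matched into exactly one half, and within a half \<open>inner_pattern\<close>
  carries this from \<open>U 1\<close> over to \<open>V 1\<close>.\<close>

lemma uses_exactly_one:
  assumes M: "perfect_matching H M" and e: "e \<in> edges G"
  shows "uses M e 1 (V 1) \<longleftrightarrow> \<not> uses M e 2 (V 1)"
proof -
  have U1: "U 1 \<in> verts petersen" by (simp add: verts_petersen)
  have hub: "InQ e Hub \<in> verts H" using InQ_in_verts[OF e _ U1, of 1] by simp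
  have ends: "InQ e Hub \<in> ends H (QEdge e' (i', a, j)) \<longleftrightarrow> e' = e \<and> U 1 \<in> a" for e' i' a j
    using q_vertex_ends_iff[of e 1 "U 1" e' i' a j] by simp
  obtain d where d: "d \<in> M" "d \<in> edges H" "InQ e Hub \<in> ends H d"
    using perfect_matching_covers[OF M hub] .
  from d(2) have "uses M e 1 (U 1) \<or> uses M e 2 (U 1)"
  proof (cases rule: edges_H_cases)
    case (Q e' i' a j)
    then have "e' = e" "U 1 \<in> a" "i' = 1 \<or> i' = 2" using d(2,3) ends by simp_all
    then show ?thesis using d(1) Q by (auto simp: uses_def inner_def)
  qed (use d(3) in auto)
  moreover have "\<not> (uses M e 1 (U 1) \<and> uses M e 2 (U 1))"
  proof
    assume "uses M e 1 (U 1) \<and> uses M e 2 (U 1)"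
    then obtain a j b j' where *: "QEdge e (1, a, j) \<in> M" "U 1 \<in> a" "QEdge e (2, b, j') \<in> M" "U 1 \<in> b"
      by (auto simp: uses_def inner_def)
    then have "QEdge e (1, a, j) = (QEdge e (2, b, j') :: ('v, 'e) sedge)"
      using perfect_matching_unique[OF M hub] ends by blast
    then show False by simp
  qed
  ultimately show ?thesis using inner_pattern(3)[OF M e, of 1] inner_pattern(3)[OF M e, of 2] by auto
qed

section \<open>Matching edges at contact vertices and triangles\<close>

lemma joined_iff:
  assumes M: "perfect_matching H M" and v: "v \<in> verts G" and inc: "e \<in> incident G v"
  shows "joined M v e \<longleftrightarrow> \<not> uses M e (side v e) (V 1)"
proof -
  have e: "e \<in> edges G" using inc by (simp add: incident_def)
  have V1: "V 1 \<in> verts petersen" by (simp add: verts_petersen)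
  let ?w = "InQ e (q_vertex (side v e) (V 1)) :: ('v, 'e) svertex"
  have w: "?w \<in> verts H" by (rule InQ_in_verts[OF e side_in V1])
  obtain d where d: "d \<in> M" "d \<in> edges H" "?w \<in> ends H d"
    using perfect_matching_covers[OF M w] .
  from d(2) have "joined M v e \<or> uses M e (side v e) (V 1)"
  proof (cases rule: edges_H_cases)
    case (Q e' i' a j)
    then have "e' = e" "i' = side v e" "V 1 \<in> a" using d(3) by (simp_all del: ends_H q_vertex_simps)
    then show ?thesis using d(1) Q by (auto simp: uses_def inner_def)
  next
    case (J v' e' x j)
    then have "e' = e" "side v' e = side v e" "e \<in> incident G v'" using d(2,3) by auto
    moreover have "v' = v"
    \<comment> \<open>The two ends of \<open>e\<close> are assigned to different halves, so equal
      sides force equal ends.\<close>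
    proof (rule ccontr)
      assume "v' \<noteq> v"
      moreover have "card (ends G e) = 2" "v \<in> ends G e" "v' \<in> ends G e"
        using graph_G e inc \<open>e \<in> incident G v'\<close> by (auto simp: graph_def incident_def)
      ultimately have "ends G e = {v, v'}" by (auto simp: card_2_iff)
      then show False using incident_side(6)[OF e] \<open>v' \<noteq> v\<close> \<open>side v' e = side v e\<close> by metis
    qed
    ultimately show ?thesis using d(1) J by (auto simp: joined_def)
  qed (use d(3) in auto)
  moreover have "\<not> (joined M v e \<and> uses M e (side v e) (V 1))"
  proof
    assume "joined M v e \<and> uses M e (side v e) (V 1)"
    then obtain x j a j' where *: "Join v e x j \<in> M" "QEdge e (side v e, a, j') \<in> M" "V 1 \<in> a"
      by (auto simp: joined_def uses_def inner_def)
    moreover have "?w \<in> ends H (Join v e x j)" by simp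
    moreover have "?w \<in> ends H (QEdge e (side v e, a, j'))" using *(3) by (simp del: ends_H q_vertex_simps)
    ultimately have "Join v e x j = (QEdge e (side v e, a, j') :: ('v, 'e) sedge)"
      using perfect_matching_unique[OF M w] by blast
    then show False by simp
  qed
  ultimately show ?thesis by blast
qed

text \<open>A triangle edge of \<open>M\<close> covers two of the three triangle vertices and a join
  covers one, so the number of joins is odd. The proof checks this over three truth values
  \<open>t\<close> for pairs and six values \<open>l\<close> for joins.\<close>

lemma odd_card_joined:
  assumes M: "perfect_matching H M" and v: "v \<in> verts G"
  shows "odd (card {e \<in> incident G v. joined M v e})"
proof -
  have bij: "bij_betw (p v) (incident G v) T_pairs" using choice v by (simp add: S_choice_def)
  have P: "{1, 2} \<in> T_pairs" "{2, 3} \<in> T_pairs" "{3, 1} \<in> T_pairs" by (auto simp: T_pairs_def)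
  obtain a where a: "a \<in> incident G v" "p v a = {1, 2}" using incident_of_pair[OF v P(1)] .
  obtain b where b: "b \<in> incident G v" "p v b = {2, 3}" using incident_of_pair[OF v P(2)] .
  obtain c where c: "c \<in> incident G v" "p v c = {3, 1}" using incident_of_pair[OF v P(3)] .
  have inc: "incident G v = {a, b, c}"
  proof
    show "incident G v \<subseteq> {a, b, c}"
    proof
      fix e assume e: "e \<in> incident G v"
      then have "p v e = p v a \<or> p v e = p v b \<or> p v e = p v c"
        using p_T_pairs[OF v e] unfolding T_pairs_def a b c by simp
      then show "e \<in> {a, b, c}" using bij e a(1) b(1) c(1) unfolding bij_betw_def inj_on_def by blast
    qed
  qed (use a b c in blast)
  have distinct: "a \<noteq> b" "a \<noteq> c" "b \<noteq> c" using a(2) b(2) c(2) by (auto simp: doubleton_eq_iff)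
  define t where "t P \<longleftrightarrow> (\<exists>j. TEdge v (P, j) \<in> M)" for P
  define l where "l e x \<longleftrightarrow> (\<exists>j. Join v e x j \<in> M)" for e x
  have ME: "M \<subseteq> edges H" using M by (simp add: perfect_matching_def)
  have l_p: "x \<in> p v e" if "l e x" for e x using that ME by (auto simp: l_def)
  have joined_l: "joined M v e \<longleftrightarrow> (\<exists>x\<in>p v e. l e x)" for e
    using l_p[of e] unfolding joined_def l_def by blast
  have joined: "joined M v a \<longleftrightarrow> l a 1 \<or> l a 2" "joined M v b \<longleftrightarrow> l b 2 \<or> l b 3"
    "joined M v c \<longleftrightarrow> l c 3 \<or> l c 1"
    unfolding joined_l a(2) b(2) c(2) by simp_all
  have cover: "(\<exists>P\<in>T_pairs. x \<in> P \<and> t P) \<or> (\<exists>e\<in>{a, b, c}. x \<in> p v e \<and> l e x)" if "x \<in> {1, 2, 3}" for x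
  proof -
    have "InT v x \<in> verts H" using v that by simp
    with M obtain d where d: "d \<in> M" "d \<in> edges H" "InT v x \<in> ends H d"
      by (rule perfect_matching_covers)
    from d(2) show ?thesis
    proof (cases rule: edges_H_cases)
      case (T v' P j)
      then have "v' = v" "x \<in> P" "P \<in> T_pairs" using d by auto
      then show ?thesis using d(1) T by (auto simp: t_def)
    next
      case (J v' e y j)
      then have "v' = v" "y = x" "e \<in> incident G v" "x \<in> p v e" using d by auto
      then show ?thesis using d(1) J unfolding l_def inc by blast
    qed (use d(3) in auto)
  qed
  have tt: "P = P'" if "t P" "t P'" "x \<in> P" "x \<in> P'" "x \<in> {1, 2, 3}" for P P' x
  proof -
    obtain j j' where "TEdge v (P, j) \<in> M" "TEdge v (P', j') \<in> M" using \<open>t P\<close> \<open>t P'\<close> by (auto simp: t_def)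
    moreover have "InT v x \<in> ends H (TEdge v (P, j))" "InT v x \<in> ends H (TEdge v (P', j'))"
      using that by auto
    moreover have "InT v x \<in> verts H" using v that(5) by simp
    ultimately have "TEdge v (P, j) = (TEdge v (P', j') :: ('v, 'e) sedge)" using perfect_matching_unique[OF M] by blast
    then show ?thesis by simp
  qed
  have tl: "\<not> (t P \<and> l e x)" if "x \<in> P" "x \<in> {1, 2, 3}" for P e x
  proof
    assume "t P \<and> l e x"
    then obtain j j' where "TEdge v (P, j) \<in> M" "Join v e x j' \<in> M" by (auto simp: t_def l_def)
    moreover have "InT v x \<in> ends H (TEdge v (P, j))" "InT v x \<in> ends H (Join v e x j')"
      using that by auto
    moreover have "InT v x \<in> verts H" using v that(2) by simp
    ultimately have "TEdge v (P, j) = (Join v e x j' :: ('v, 'e) sedge)" using perfect_matching_unique[OF M] by blast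
    then show False by simp
  qed
  have ll: "e = e'" if "l e x" "l e' x" "x \<in> {1, 2, 3}" for e e' x
  proof -
    obtain j j' where "Join v e x j \<in> M" "Join v e' x j' \<in> M" using \<open>l e x\<close> \<open>l e' x\<close> by (auto simp: l_def)
    moreover have "InT v x \<in> ends H (Join v e x j)" "InT v x \<in> ends H (Join v e' x j')" by auto
    moreover have "InT v x \<in> verts H" using v that(3) by simp
    ultimately have "Join v e x j = (Join v e' x j' :: ('v, 'e) sedge)" using perfect_matching_unique[OF M] by blast
    then show ?thesis by simp
  qed
  \<comment> \<open>A contact vertex is matched only once, so counting joins agrees with counting
    joined edges of \<open>G\<close>.\<close>
  have ll': "x = y" if "l e x" "l e y" "e \<in> incident G v" for e x y
  proof -
    obtain j j' where "Join v e x j \<in> M" "Join v e y j' \<in> M" 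
      using \<open>l e x\<close> \<open>l e y\<close> by (auto simp: l_def)
    moreover have "InQ e (q_vertex (side v e) (V 1)) \<in> ends H (Join v e x j)"
      "InQ e (q_vertex (side v e) (V 1)) \<in> ends H (Join v e y j')" by auto
    moreover have "InQ e (q_vertex (side v e) (V 1)) \<in> verts H"
      using that(3) by (intro InQ_in_verts side_in) (simp_all add: incident_def verts_petersen)
    ultimately have "Join v e x j = (Join v e y j' :: ('v, 'e) sedge)" using perfect_matching_unique[OF M] by blast
    then show ?thesis by simp
  qed
  have cov: "t {1, 2} \<or> t {3, 1} \<or> l a 1 \<or> l c 1" "t {1, 2} \<or> t {2, 3} \<or> l a 2 \<or> l b 2"
    "t {2, 3} \<or> t {3, 1} \<or> l b 3 \<or> l c 3"
    using cover[of 1] cover[of 2] cover[of 3] unfolding T_pairs_def by (auto simp: a b c)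
  have excl_t: "\<not> (t {1, 2} \<and> t {2, 3})" "\<not> (t {1, 2} \<and> t {3, 1})" "\<not> (t {2, 3} \<and> t {3, 1})"
    using tt[of "{1, 2}" "{2, 3}" 2] tt[of "{1, 2}" "{3, 1}" 1] tt[of "{2, 3}" "{3, 1}" 3]
    by (auto simp: doubleton_eq_iff)
  have excl_tl: "\<not> (t {1, 2} \<and> (l a 1 \<or> l c 1 \<or> l a 2 \<or> l b 2))" "\<not> (t {2, 3} \<and> (l a 2 \<or> l b 2 \<or> l b 3 \<or> l c 3))"
    "\<not> (t {3, 1} \<and> (l a 1 \<or> l c 1 \<or> l b 3 \<or> l c 3))"
    using tl[of 1 "{1, 2}"] tl[of 2 "{1, 2}"] tl[of 2 "{2, 3}"] tl[of 3 "{2, 3}"] tl[of 1 "{3, 1}"] tl[of 3 "{3, 1}"]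
    by auto
  have excl_l: "\<not> (l a 1 \<and> l c 1)" "\<not> (l a 2 \<and> l b 2)" "\<not> (l b 3 \<and> l c 3)"
    "\<not> (l a 1 \<and> l a 2)" "\<not> (l b 2 \<and> l b 3)" "\<not> (l c 3 \<and> l c 1)"
    using ll[of a 1 c] ll[of a 2 b] ll[of b 3 c] distinct ll'[of a 1 2] ll'[of b 2 3] ll'[of c 3 1] a(1) b(1) c(1)
    by auto
  \<comment> \<open>For three truth values, this nested equivalence says that an odd number of them
    hold.\<close>
  have parity: "joined M v a \<longleftrightarrow> (joined M v b \<longleftrightarrow> joined M v c)"
    using cov excl_t excl_tl excl_l unfolding joined by smt
  have "{e \<in> incident G v. joined M v e} = (if joined M v a then {a} else {}) \<union>
    (if joined M v b then {b} else {}) \<union> (if joined M v c then {c} else {})"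
    unfolding inc by auto
  then show ?thesis
    using parity distinct
    by (cases "joined M v a"; cases "joined M v b"; cases "joined M v c") simp_all
qed

section \<open>Counting over a family of disjoint perfect matchings\<close>

lemma card_containing:
  assumes Ms: "finite \<M>" "\<And>M. M \<in> \<M> \<Longrightarrow> perfect_matching H M" "pairwise disjnt \<M>"
  shows "card {M \<in> \<M>. d \<in> inner M e i} \<le> mult k d"
proof -
  \<comment> \<open>\<open>g\<close> selects a copy of \<open>d\<close> used by \<open>M\<close>;
    disjoint matchings use different copies, so it is injective into the available indices.\<close>
  define g where "g M = (SOME j. QEdge e (i, d, j) \<in> M)" for M :: "('v, 'e) sedge set"
  have g: "QEdge e (i, d, g M) \<in> M" if "d \<in> inner M e i" for M
    using that unfolding g_def inner_def mem_Collect_eq by (rule someI_ex)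
  have "inj_on g {M \<in> \<M>. d \<in> inner M e i}"
  proof (rule inj_onI)
    fix M M' assume MM: "M \<in> {M \<in> \<M>. d \<in> inner M e i}" "M' \<in> {M \<in> \<M>. d \<in> inner M e i}" "g M = g M'"
    then have "QEdge e (i, d, g M) \<in> M" "QEdge e (i, d, g M) \<in> M'" using g[of M] g[of M'] by simp_all
    then show "M = M'" using MM(1,2) Ms(3) unfolding pairwise_def disjnt_def by blast
  qed
  moreover have "g ` {M \<in> \<M>. d \<in> inner M e i} \<subseteq> {..<mult k d}"
  proof safe
    fix M assume "M \<in> \<M>" "d \<in> inner M e i"
    then have "QEdge e (i, d, g M) \<in> edges H" using g Ms(2) unfolding perfect_matching_def by blast
    then show "g M < mult k d" by simp
  qed
  ultimately show ?thesis using card_inj_on_le[of g _ "{..<mult k d}"] by simp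
qed

lemma card_uses:
  assumes Ms: "finite \<M>" "\<And>M. M \<in> \<M> \<Longrightarrow> perfect_matching H M" "pairwise disjnt \<M>"
    and e: "e \<in> edges G" "i \<in> {1, 2}"
  shows "card {M \<in> \<M>. uses M e i (V 1)} \<le> 2 * k - 1"
proof -
  define a where "a M \<longleftrightarrow> {V 1, V 2} \<in> inner M e i" for M
  define b where "b M \<longleftrightarrow> {U 1, U 3} \<in> inner M e i" for M
  \<comment> \<open>The classes correspond to the four traces: \<open>A True True\<close> to
    \<open>PM 5\<close>, \<open>A True False\<close> to \<open>PM 3\<close>,
    \<open>A False True\<close> to \<open>PM 4\<close>, \<open>A False False\<close> to
    \<open>PM 2\<close>. Two classes whose traces share an edge are together bounded by its
    multiplicity.\<close>
  define A where "A s t = {M \<in> \<M>. uses M e i (V 1) \<and> a M = s \<and> b M = t}" for s t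
  have fin: "finite (A s t)" for s t using Ms(1) by (simp add: A_def)
  have le: "card (A s t) + card (A s' t') \<le> mult k d"
    if "(s, t) \<noteq> (s', t')"
      and "\<And>M. M \<in> A s t \<union> A s' t' \<Longrightarrow> d \<in> inner M e i" for s t s' t' d
  proof -
    have "card (A s t) + card (A s' t') = card (A s t \<union> A s' t')"
      using that(1) fin by (intro card_Un_disjoint[symmetric]) (auto simp: A_def)
    also have "\<dots> \<le> card {M \<in> \<M>. d \<in> inner M e i}"
      using that(2) Ms(1) by (intro card_mono) (auto simp: A_def)
    also have "\<dots> \<le> mult k d" by (rule card_containing[OF Ms])
    finally show ?thesis .
  qed
  have pattern: "if s = t then {V 3, V 4} \<in> inner M e i else {U 5, U 2} \<in> inner M e i"
      "s \<Longrightarrow> {V 1, V 2} \<in> inner M e i" "\<not> s \<Longrightarrow> {V 5, V 1} \<in> inner M e i"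
      "t \<Longrightarrow> {U 1, U 3} \<in> inner M e i" "\<not> t \<Longrightarrow> {U 4, U 1} \<in> inner M e i"
    if "M \<in> A s t" for s t M
  proof -
    have M: "perfect_matching H M" "uses M e i (V 1)" "s = ({V 1, V 2} \<in> inner M e i)" "t = ({U 1, U 3} \<in> inner M e i)"
      using that Ms(2) by (auto simp: A_def a_def b_def)
    note pat = inner_pattern[OF M(1) e]
    show "if s = t then {V 3, V 4} \<in> inner M e i else {U 5, U 2} \<in> inner M e i"
      using pat(4)[OF M(2)] unfolding M(3,4) .
    show "s \<Longrightarrow> {V 1, V 2} \<in> inner M e i" "t \<Longrightarrow> {U 1, U 3} \<in> inner M e i" using M(3,4) by simp_all
    show "\<not> s \<Longrightarrow> {V 5, V 1} \<in> inner M e i" "\<not> t \<Longrightarrow> {U 4, U 1} \<in> inner M e i"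
      using pat(1-3) M(2-4) by blast+
  qed
  have "card (A True True) + card (A True False) \<le> mult k {V 1, V 2}"
    by (rule le) (use pattern(2)[of _ True True] pattern(2)[of _ True False] in blast)+
  moreover have "card (A False True) + card (A False False) \<le> mult k {V 5, V 1}"
    by (rule le) (use pattern(3)[of _ False True] pattern(3)[of _ False False] in blast)+
  moreover have "card (A True True) + card (A False True) \<le> mult k {U 1, U 3}"
    by (rule le) (use pattern(4)[of _ True True] pattern(4)[of _ False True] in blast)+
  moreover have "card (A True False) + card (A False False) \<le> mult k {U 4, U 1}"
    by (rule le) (use pattern(5)[of _ True False] pattern(5)[of _ False False] in blast)+
  moreover have "card (A True True) + card (A False False) \<le> mult k {V 3, V 4}"
    by (rule le) (use pattern(1)[of _ True True, simplified] pattern(1)[of _ False False, simplified] in blast)+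
  moreover have "card (A True False) + card (A False True) \<le> mult k {U 5, U 2}"
    by (rule le) (use pattern(1)[of _ True False, simplified] pattern(1)[of _ False True, simplified] in blast)+
  moreover have "card {M \<in> \<M>. uses M e i (V 1)} \<le>
    card (A True True) + card (A True False) + (card (A False True) + card (A False False))"
  proof -
    have "{M \<in> \<M>. uses M e i (V 1)} \<subseteq> (A True True \<union> A True False) \<union> (A False True \<union> A False False)"
      by (auto simp: A_def)
    then have "card {M \<in> \<M>. uses M e i (V 1)} \<le> card ((A True True \<union> A True False) \<union> (A False True \<union> A False False))"
      using fin by (intro card_mono) auto
    also have "\<dots> \<le> card (A True True \<union> A True False) + card (A False True \<union> A False False)"
      by (rule card_Un_le)
    also have "\<dots> \<le> card (A True True) + card (A True False) + (card (A False True) + card (A False False))"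
      by (intro add_mono card_Un_le)
    finally show ?thesis .
  qed
  \<comment> \<open>The simple edge \<open>{V 3, V 4}\<close> allows at most one matching in
    \<open>A True True\<close> and \<open>A False False\<close> together. If there is none, the
    bound is the multiplicity \<open>2 * k - 1\<close> of \<open>{U 5, U 2}\<close>. If there is
    one, the bounds \<open>k\<close> at \<open>V 1\<close> and \<open>U 1\<close> leave at most
    \<open>k - 1\<close> for each of the other two classes.\<close>
  ultimately show ?thesis
    using k_pos unfolding mult_simps[OF k_pos]
    by (cases "card (A True True)"; cases "card (A False False)") linarith+
qed

text \<open>Every matching is counted at exactly one of the two halves, each half allows at most
  \<open>2 * k - 1\<close>, and these two bounds add up to \<open>card \<M>\<close>; so both are
  attained.\<close>

lemma card_joined:
  assumes Ms: "finite \<M>" "\<And>M. M \<in> \<M> \<Longrightarrow> perfect_matching H M" "pairwise disjnt \<M>"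
    and card: "card \<M> = 4 * k - 2" and v: "v \<in> verts G" and inc: "e \<in> incident G v"
  shows "card {M \<in> \<M>. joined M v e} = 2 * k - 1"
proof -
  have e: "e \<in> edges G" using inc by (simp add: incident_def)
  \<comment> \<open>The opposite half: a matching joins \<open>v\<close> to the copy at
    \<open>e\<close> exactly when it matches the contact vertex of half \<open>i\<close> inside that
    half.\<close>
  define i where "i = 3 - side v e"
  have i: "i \<in> {1, 2}" "(side v e, i) = (1, 2) \<or> (side v e, i) = (2, 1)" using side_in[of v e] by (auto simp: i_def)
  have neg: "\<not> uses M e (side v e) (V 1) \<longleftrightarrow> uses M e i (V 1)" if "M \<in> \<M>" for M
    using uses_exactly_one[OF Ms(2)[OF that] e] i(2) by auto
  let ?X = "{M \<in> \<M>. uses M e (side v e) (V 1)}" and ?Y = "{M \<in> \<M>. uses M e i (V 1)}"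
  have "\<M> = ?X \<union> ?Y" "?X \<inter> ?Y = {}" using neg by blast+
  then have "card \<M> = card ?X + card ?Y" using Ms(1) by (metis (no_types, lifting) card_Un_disjoint finite_Un)
  moreover have "card ?X \<le> 2 * k - 1" by (rule card_uses[OF Ms e side_in])
  moreover have "card ?Y \<le> 2 * k - 1" by (rule card_uses[OF Ms e i(1)])
  ultimately have "card ?Y = 2 * k - 1" using card by linarith
  moreover have "{M \<in> \<M>. joined M v e} = ?Y" using joined_iff[OF Ms(2) v inc] neg by blast
  ultimately show ?thesis by simp
qed

lemma no_disjoint_perfect_matchings:
  assumes "verts G \<noteq> {}"
  shows "\<not> has_disjoint_perfect_matchings (4 * k - 2) H"
proof
  assume "has_disjoint_perfect_matchings (4 * k - 2) H"
  then obtain \<M> where Ms: "finite \<M>" "\<And>M. M \<in> \<M> \<Longrightarrow> perfect_matching H M" "pairwise disjnt \<M>"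
    and card: "card \<M> = 4 * k - 2"
    unfolding has_disjoint_perfect_matchings_def by blast
  obtain v where v: "v \<in> verts G" using assms by blast
  \<comment> \<open>Double counting of pairs of a matching and an edge joined to the triangle at
    \<open>v\<close>.\<close>
  have "(\<Sum>M\<in>\<M>. card {e \<in> incident G v. joined M v e}) = (\<Sum>e\<in>incident G v. card {M \<in> \<M>. joined M v e})"
    using Ms(1) finite_incident by (intro sum_multicount_gen) simp_all
  also have "\<dots> = 3 * (2 * k - 1)"
    using card_joined[OF Ms card v] cubic v by (simp add: regular_def)
  finally have sum: "(\<Sum>M\<in>\<M>. card {e \<in> incident G v. joined M v e}) = 3 * (2 * k - 1)" .
  have "{M \<in> \<M>. odd (card {e \<in> incident G v. joined M v e})} = \<M>"
    using odd_card_joined[OF Ms(2) v] by blast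
  then have "even (\<Sum>M\<in>\<M>. card {e \<in> incident G v. joined M v e}) \<longleftrightarrow> even (card \<M>)"
    using Ms(1) by (simp add: even_sum_iff)
  moreover have "even (card \<M>)" unfolding card by simp
  ultimately show False using k_pos unfolding sum by simp
qed

end

theorem theorem2p7:
  fixes G :: "('v, 'e) mgraph" and k :: nat
    and f :: "'e \<Rightarrow> 'v" and p :: "'v \<Rightarrow> 'e \<Rightarrow> nat set"
  assumes "graph G" and "connected G" and "bridgeless G" and "regular 3 G"
    and "even (card (edges G))"
    and "k \<ge> 1"
    and "S_choice G f p"
  shows "edge_connected (4 * k) (S_graph k G f p) \<and>
         r_graph (4 * k) (S_graph k G f p) \<and>
         \<not> has_disjoint_perfect_matchings (4 * k - 2) (S_graph k G f p)"
proof -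
  interpret S_construction G k f p
    using assms by unfold_locales
  have "verts G \<noteq> {}" using assms(2) by (simp add: connected_def)
  then show ?thesis
    using edge_connected_H r_graph_H no_disjoint_perfect_matchings assms by blast
qed

end
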